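(* Let $p$ be an odd prime, $n\geq 1$ an integer, and $q=p^{2n}$. There exists a projective plane $\Sigma$ of order $q$ and a polarity $\theta$ of $\Sigma$ that is neither orthogonal nor unitary, such that the polarity graph $G(\Sigma,\theta)$ satisfies \[ \alpha(G(\Sigma,\theta)) \geq \tfrac{1}{2} q(\sqrt{q}-1). \]
   Context: For a projective plane $\Sigma=(\mathcal{P},\mathcal{L},\mathcal{I})$ of order $q$, a polarity is a bijection $\theta$ of $\mathcal{P}\cup\mathcal{L}$ with $\theta(\mathcal{P})=\mathcal{L}$, $\theta(\mathcal{L})=\mathcal{P}$, $\theta^2=\mathrm{id}$, and $p\,\mathcal{I}\,l$ iff $l^\theta\,\mathcal{I}\,p^\theta$. A point $p$ is absolute if $p\,\mathcal{I}\,p^\theta$. The polarity is orthogonal if it has exactly $q+1$ absolute points, and unitary if it has exactly $q^{3/2}+1$ absolute points. The polarity graph $G(\Sigma,\theta)$ has vertex set $\mathcal{P}$, with distinct points $p_1,p_2$ adjacent iff $p_1\,\mathcal{I}\,p_2^\theta$. $\alpha$ denotes the independence number. *)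

theory Defs
  imports Complex_Main "HOL-Computational_Algebra.Primes"
begin

definition projective_plane :: "'p set \<Rightarrow> 'l set \<Rightarrow> ('p \<Rightarrow> 'l \<Rightarrow> bool) \<Rightarrow> bool" where
  "projective_plane P L I \<longleftrightarrow>
     finite P \<and> finite L \<and>
     (\<forall>x\<in>P. \<forall>y\<in>P. x \<noteq> y \<longrightarrow> (\<exists>!l. l \<in> L \<and> I x l \<and> I y l)) \<and>
     (\<forall>l\<in>L. \<forall>m\<in>L. l \<noteq> m \<longrightarrow> (\<exists>!x. x \<in> P \<and> I x l \<and> I x m)) \<and>
     (\<exists>Q. Q \<subseteq> P \<and> card Q = 4 \<and>
        (\<forall>l\<in>L. card {x\<in>Q. I x l} \<le> 2))"

definition projective_plane_of_order :: "'p set \<Rightarrow> 'l set \<Rightarrow> ('p \<Rightarrow> 'l \<Rightarrow> bool) \<Rightarrow> nat \<Rightarrow> bool" where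
  "projective_plane_of_order P L I q \<longleftrightarrow>
     projective_plane P L I \<and> (\<forall>l\<in>L. card {x\<in>P. I x l} = q + 1)"

text \<open>A polarity, given by its restrictions tpt : points \<rightarrow> lines and tln : lines \<rightarrow> points
  (a bijection of P \<union> L swapping P and L, of order 2, with p I l iff l^\<theta> I p^\<theta>).\<close>
definition is_polarity :: "'p set \<Rightarrow> 'l set \<Rightarrow> ('p \<Rightarrow> 'l \<Rightarrow> bool) \<Rightarrow> ('p \<Rightarrow> 'l) \<Rightarrow> ('l \<Rightarrow> 'p) \<Rightarrow> bool" where
  "is_polarity P L I tpt tln \<longleftrightarrow>
     (\<forall>x\<in>P. tpt x \<in> L) \<and> (\<forall>l\<in>L. tln l \<in> P) \<and>
     (\<forall>x\<in>P. tln (tpt x) = x) \<and> (\<forall>l\<in>L. tpt (tln l) = l) \<and>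
     (\<forall>x\<in>P. \<forall>l\<in>L. I x l \<longleftrightarrow> I (tln l) (tpt x))"

definition absolute_points :: "'p set \<Rightarrow> ('p \<Rightarrow> 'l \<Rightarrow> bool) \<Rightarrow> ('p \<Rightarrow> 'l) \<Rightarrow> 'p set" where
  "absolute_points P I tpt = {x\<in>P. I x (tpt x)}"

definition orthogonal_polarity :: "'p set \<Rightarrow> ('p \<Rightarrow> 'l \<Rightarrow> bool) \<Rightarrow> ('p \<Rightarrow> 'l) \<Rightarrow> nat \<Rightarrow> bool" where
  "orthogonal_polarity P I tpt q \<longleftrightarrow> card (absolute_points P I tpt) = q + 1"

definition unitary_polarity :: "'p set \<Rightarrow> ('p \<Rightarrow> 'l \<Rightarrow> bool) \<Rightarrow> ('p \<Rightarrow> 'l) \<Rightarrow> nat \<Rightarrow> bool" where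
  "unitary_polarity P I tpt q \<longleftrightarrow>
     real (card (absolute_points P I tpt)) = real q powr (3/2) + 1"

definition polarity_adj :: "('p \<Rightarrow> 'l \<Rightarrow> bool) \<Rightarrow> ('p \<Rightarrow> 'l) \<Rightarrow> 'p \<Rightarrow> 'p \<Rightarrow> bool" where
  "polarity_adj I tpt x y \<longleftrightarrow> x \<noteq> y \<and> I x (tpt y)"

definition independent_set :: "'p set \<Rightarrow> ('p \<Rightarrow> 'p \<Rightarrow> bool) \<Rightarrow> 'p set \<Rightarrow> bool" where
  "independent_set V adj S \<longleftrightarrow> S \<subseteq> V \<and> (\<forall>x\<in>S. \<forall>y\<in>S. \<not> adj x y)"

definition independence_number :: "'p set \<Rightarrow> ('p \<Rightarrow> 'p \<Rightarrow> bool) \<Rightarrow> nat" where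
  "independence_number V adj = Max (card ` {S. independent_set V adj S})"

end

theory Submission
  imports "HOL-Algebra.Algebraic_Closure" "HOL-Number_Theory.Residues" Defs
begin

text \<open>
  Put $m = p^n$, $q = m^2$, let $K$ be the field of order $q$ and $F$ its subfield of order $m$, and
  write $\bar x = x^m$. The plane is the Hughes plane of order $q$. Its points are the nonzero vectors
  of $K^3$ modulo the identifications of $v$ with $k v$ for squares $k \neq 0$ and with $k \bar v$ for
  nonsquares $k$; these $F$-linear maps of $K$ form the multiplicative group of the regular nearfield.
  Fix a symmetric bilinear form $B$ with coefficients in $F$. Lines are represented by vectors as well,
  and $v$ lies on $u$ if the $F$-linear map sending $x$ to $B(u, v)\, x + B(\bar u, v)\, \bar x$ is zero
  or one of these nearfield multiplications. This relation is symmetric in $u$ and $v$, so the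
  identity on vectors is a polarity. It has exactly $1 + m (m^2 + 1) / 2$ absolute points, which is
  neither $m^2 + 1$ nor $m^3 + 1$, and the absolute points of any polarity are pairwise nonadjacent
  in its polarity graph.
\<close>

section \<open>Planes from symmetric incidence relations\<close>

text \<open>Only uniqueness of joins needs algebra: with q^2 + q + 1 points and q + 1 of them on
  each line, counting turns it into existence, and the symmetry of incidence gives the dual axiom.
  The map in the incidence relation sends x to the pairing of v with x u + conj(x) conj(u), a vector
  over F; thus v is paired with the traces of all multiples of u. The obstacle is the nearfield
  twist. A line is in general not a K-subspace, so linear algebra settles only those configurations
  in which all four incidences between two points and two lines can be made K-linear at once. In the
  remaining one, an F-linear dependence between the traces of the two points is paired with both
  lines, and the quadratic characters of the coefficients are compared. The decisive facts about
  squares come from two parities: m + 1 is even, so every element of F is a square in K, and m - 1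
  is even, so conj(x) / x is a square. The count of absolute points uses that the quotient of two
  elements with conj(x) = -x lies in F and so is a square.\<close>

lemma symmetric_incidence_common_neighbour:
  assumes fin: "finite P" and card: "card P = q\<^sup>2 + q + 1"
    and sym: "\<And>x y. x \<in> P \<Longrightarrow> y \<in> P \<Longrightarrow> I x y \<longleftrightarrow> I y x"
    and deg: "\<And>x. x \<in> P \<Longrightarrow> card {y \<in> P. I x y} = q + 1"
    and uniq: "\<And>x y u v. \<lbrakk>x \<in> P; y \<in> P; u \<in> P; v \<in> P; I x u; I y u; I x v; I y v; x \<noteq> y\<rbrakk> \<Longrightarrow> u = v"
    and x: "x \<in> P" and y: "y \<in> P" and "x \<noteq> y"
  shows "\<exists>!l. l \<in> P \<and> I x l \<and> I y l"
proof -
  let ?N = "\<lambda>x. {y \<in> P. I x y}"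
  \<comment> \<open>The lines through \<open>x\<close>, with \<open>x\<close> deleted, are disjoint
    by uniqueness and together have (q + 1) q = q^2 + q elements, so they cover every other
    point.\<close>
  have "card (\<Union>l\<in>?N x. ?N l - {x}) = (\<Sum>l\<in>?N x. card (?N l - {x}))"
  proof (rule card_UN_disjoint)
    show "\<forall>i\<in>?N x. \<forall>j\<in>?N x. i \<noteq> j \<longrightarrow> (?N i - {x}) \<inter> (?N j - {x}) = {}"
    proof (intro ballI impI equals0I)
      fix i j z assume "i \<in> ?N x" "j \<in> ?N x" "i \<noteq> j" "z \<in> (?N i - {x}) \<inter> (?N j - {x})"
      then show False using uniq[of i j x z] sym x by auto
    qed
  qed (use fin in auto)
  also have "\<dots> = (\<Sum>l\<in>?N x. q)"
  proof (rule sum.cong[OF refl])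
    fix l assume "l \<in> ?N x"
    then have "x \<in> ?N l" using x sym by auto
    then show "card (?N l - {x}) = q"
      using deg[of l] \<open>l \<in> ?N x\<close> fin by (simp add: card_Diff_singleton)
  qed
  also have "\<dots> = card (P - {x})"
    using deg[OF x] card x fin by (simp add: power2_eq_square algebra_simps)
  finally have "(\<Union>l\<in>?N x. ?N l - {x}) = P - {x}"
    by (intro card_subset_eq) (use fin in auto)
  then have "y \<in> (\<Union>l\<in>?N x. ?N l - {x})" using y \<open>x \<noteq> y\<close> by auto
  then obtain l where l: "l \<in> P" "I x l" "I y l" using sym y by auto
  show ?thesis
    by (rule ex1I[of _ l]) (use l uniq[OF x y] \<open>x \<noteq> y\<close> in blast)+
qed

text \<open>The quadrangle consists of two further points on each of two lines through a common
  point \<open>o'\<close>.\<close>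

lemma symmetric_incidence_plane:
  assumes fin: "finite P" and card: "card P = q\<^sup>2 + q + 1" and "q \<ge> 2"
    and sym: "\<And>x y. x \<in> P \<Longrightarrow> y \<in> P \<Longrightarrow> I x y \<longleftrightarrow> I y x"
    and deg: "\<And>x. x \<in> P \<Longrightarrow> card {y \<in> P. I x y} = q + 1"
    and uniq: "\<And>x y u v. \<lbrakk>x \<in> P; y \<in> P; u \<in> P; v \<in> P; I x u; I y u; I x v; I y v; x \<noteq> y\<rbrakk> \<Longrightarrow> u = v"
  shows "projective_plane_of_order P P I q"
proof -
  have ex1: "\<exists>!l. l \<in> P \<and> I x l \<and> I y l" if "x \<in> P" "y \<in> P" "x \<noteq> y" for x y
    by (rule symmetric_incidence_common_neighbour[OF fin card sym deg uniq that])
  have deg': "card {x \<in> P. I x l} = q + 1" if "l \<in> P" for l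
  proof -
    have "{x \<in> P. I x l} = {x \<in> P. I l x}" using sym that by auto
    then show ?thesis using deg[OF that] by simp
  qed
  have two: "\<exists>a b. a \<in> P \<and> b \<in> P \<and> a \<noteq> b \<and> a \<noteq> x \<and> b \<noteq> x \<and> I a l \<and> I b l" if "l \<in> P" for x l
  proof -
    have "card ({x \<in> P. I x l} - {x}) \<ge> 2"
      using deg'[OF that] \<open>q \<ge> 2\<close> card_Diff1_le[of "{x \<in> P. I x l}" x] fin
      by (simp add: card_Diff_singleton_if)
    then obtain T where "T \<subseteq> {x \<in> P. I x l} - {x}" "card T = 2"
      by (rule obtain_subset_with_card_n)
    then show ?thesis by (auto simp: card_2_iff)
  qed
  have "P \<noteq> {}" using card by auto
  then obtain o' where o': "o' \<in> P" by auto
  obtain l m where lm: "l \<in> P" "m \<in> P" "l \<noteq> m" "I o' l" "I o' m"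
    using two[OF o', of o'] sym o' by blast
  obtain a b where ab: "a \<in> P" "b \<in> P" "a \<noteq> b" "a \<noteq> o'" "b \<noteq> o'" "I a l" "I b l"
    using two[OF lm(1), of o'] by blast
  obtain c d where cd: "c \<in> P" "d \<in> P" "c \<noteq> d" "c \<noteq> o'" "d \<noteq> o'" "I c m" "I d m"
    using two[OF lm(2), of o'] by blast
  have meet: "x = o'" if "x \<in> P" "I x l" "I x m" for x
    using uniq[of x o' l m] that lm o' by blast
  have dist: "a \<noteq> c" "a \<noteq> d" "b \<noteq> c" "b \<noteq> d" using meet ab cd by blast+
  have "card {x \<in> {a, b, c, d}. I x k} \<le> 2" if k: "k \<in> P" for k
  proof -
    have 1: "k = l" if "I a k" "I b k" using uniq[of a b k l] ab lm k that by blast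
    have 2: "k = m" if "I c k" "I d k" using uniq[of c d k m] cd lm k that by blast
    have 3: "\<not> I c l" "\<not> I d l" "\<not> I a m" "\<not> I b m" using meet ab cd by blast+
    \<comment> \<open>A line carrying both points of one pair is \<open>l\<close> or
      \<open>m\<close> and misses the other pair; any other line contains at most one point of each
      pair.\<close>
    obtain u v where "{x \<in> {a, b, c, d}. I x k} \<subseteq> {u, v}"
      using 1 2 3 by (cases "I a k"; cases "I b k"; cases "I c k"; cases "I d k") auto
    then have "card {x \<in> {a, b, c, d}. I x k} \<le> card {u, v}" by (intro card_mono) auto
    also have "\<dots> \<le> 2" by (simp add: card_insert_if)
    finally show ?thesis .
  qed
  then have quad: "\<exists>Q. Q \<subseteq> P \<and> card Q = 4 \<and> (\<forall>l\<in>P. card {x \<in> Q. I x l} \<le> 2)"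
    using ab cd dist by (intro exI[of _ "{a, b, c, d}"]) auto
  have dual: "\<exists>!x. x \<in> P \<and> I x l \<and> I x m" if "l \<in> P" "m \<in> P" "l \<noteq> m" for l m
  proof -
    have "(x \<in> P \<and> I x l \<and> I x m) \<longleftrightarrow> (x \<in> P \<and> I l x \<and> I m x)" for x
      using sym that by blast
    then show ?thesis using ex1[OF that] by simp
  qed
  show ?thesis
    unfolding projective_plane_of_order_def projective_plane_def
    using fin quad by (intro conjI ballI impI ex1 dual deg')
qed

text \<open>An absolute point is incident with its polar, so two adjacent absolute points would lie on
  both of their polars.\<close>

lemma absolute_points_independent:
  assumes uniq: "\<And>x y u v. \<lbrakk>x \<in> P; y \<in> P; u \<in> P; v \<in> P; I x u; I y u; I x v; I y v; x \<noteq> y\<rbrakk> \<Longrightarrow> u = v"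
    and sym: "\<And>x y. x \<in> P \<Longrightarrow> y \<in> P \<Longrightarrow> I x y \<longleftrightarrow> I y x"
  shows "independent_set P (polarity_adj I (\<lambda>x. x)) (absolute_points P I (\<lambda>x. x))"
  unfolding independent_set_def
proof (intro conjI ballI notI)
  fix x y assume xy: "x \<in> absolute_points P I (\<lambda>x. x)" "y \<in> absolute_points P I (\<lambda>x. x)"
    and "polarity_adj I (\<lambda>x. x) x y"
  then show False
    using uniq[of x y x y] sym[of x y] by (simp add: polarity_adj_def absolute_points_def)
qed (auto simp: absolute_points_def)

lemma card_le_independence_number:
  assumes "finite V" "independent_set V adj S"
  shows "card S \<le> independence_number V adj"
  unfolding independence_number_def
proof (rule Max_ge)
  have "{S. independent_set V adj S} \<subseteq> Pow V" by (auto simp: independent_set_def)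
  then show "finite (card ` {S. independent_set V adj S})"
    using assms(1) finite_subset by blast
qed (use assms in auto)

text \<open>The theorem asks for a plane on natural numbers, so the incidence relation is pulled
  back along an enumeration of the points. Points and lines share one set, which makes the identity
  a polarity.\<close>

lemma symmetric_incidence_polarity:
  fixes P :: "'a set"
  assumes fin: "finite P" and card: "card P = q\<^sup>2 + q + 1" and "q \<ge> 2"
    and sym: "\<And>x y. x \<in> P \<Longrightarrow> y \<in> P \<Longrightarrow> I x y \<longleftrightarrow> I y x"
    and deg: "\<And>x. x \<in> P \<Longrightarrow> card {y \<in> P. I x y} = q + 1"
    and uniq: "\<And>x y u v. \<lbrakk>x \<in> P; y \<in> P; u \<in> P; v \<in> P; I x u; I y u; I x v; I y v; x \<noteq> y\<rbrakk> \<Longrightarrow> u = v"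
  shows "\<exists>(P' :: nat set) I'. projective_plane_of_order P' P' I' q \<and>
    is_polarity P' P' I' (\<lambda>x. x) (\<lambda>x. x) \<and>
    card (absolute_points P' I' (\<lambda>x. x)) = card {x \<in> P. I x x} \<and>
    card {x \<in> P. I x x} \<le> independence_number P' (polarity_adj I' (\<lambda>x. x))"
proof -
  obtain f where f: "bij_betw f {0..<card P} P"
    using ex_bij_betw_nat_finite[OF fin] by blast
  define P' where "P' = {0..<card P}"
  define I' where "I' i j = I (f i) (f j)" for i j
  have fP: "f i \<in> P" if "i \<in> P'" for i using f that by (auto simp: P'_def bij_betw_def)
  have inj: "f i = f j \<longleftrightarrow> i = j" if "i \<in> P'" "j \<in> P'" for i j
    using f that by (auto simp: P'_def bij_betw_def inj_on_def)
  have surj: "P = f ` P'" using bij_betw_imp_surj_on[OF f] by (simp add: P'_def)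
  have count: "card {i \<in> P'. A (f i)} = card {x \<in> P. A x}" for A
  proof -
    have "{x \<in> P. A x} = f ` {i \<in> P'. A (f i)}"
      unfolding surj by auto
    then show ?thesis
      using inj by (simp add: card_image inj_on_def)
  qed
  have sym': "I' i j \<longleftrightarrow> I' j i" if "i \<in> P'" "j \<in> P'" for i j
    using sym fP that by (simp add: I'_def)
  have uniq': "u = v" if "x \<in> P'" "y \<in> P'" "u \<in> P'" "v \<in> P'" "I' x u" "I' y u" "I' x v" "I' y v" "x \<noteq> y"
    for x y u v
    using uniq[of "f x" "f y" "f u" "f v"] that fP inj by (auto simp: I'_def)
  have "projective_plane_of_order P' P' I' q"
  proof (rule symmetric_incidence_plane)
    show "card {y \<in> P'. I' x y} = q + 1" if "x \<in> P'" for x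
      using count[of "I (f x)"] deg[OF fP[OF that]] by (simp add: I'_def)
    show "finite P'" "card P' = q\<^sup>2 + q + 1" by (simp_all add: P'_def card)
  qed (fact \<open>q \<ge> 2\<close> sym' uniq')+
  moreover have "is_polarity P' P' I' (\<lambda>x. x) (\<lambda>x. x)"
    unfolding is_polarity_def using sym' by blast
  moreover have "card (absolute_points P' I' (\<lambda>x. x)) = card {x \<in> P. I x x}"
    using count[of "\<lambda>x. I x x"] by (simp add: absolute_points_def I'_def)
  moreover have "card (absolute_points P' I' (\<lambda>x. x)) \<le> independence_number P' (polarity_adj I' (\<lambda>x. x))"
    by (rule card_le_independence_number[OF _ absolute_points_independent[OF uniq' sym']])
      (simp_all add: P'_def)
  ultimately show ?thesis by auto
qed

section \<open>Finite fields\<close>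

lemma (in ring_hom_ring) hom_add_pow:
  "x \<in> carrier R \<Longrightarrow> h ([(n::nat)] \<cdot> x) = [n] \<cdot>\<^bsub>S\<^esub> h x"
  by (induction n) (simp_all add: R.add.nat_pow_Suc S.add.nat_pow_Suc)

context cring
begin

text \<open>Serves for the rewriting X - a = (X^q - a) - (X^q - X), from which the simplicity of the
  roots of X^q - X follows.\<close>

lemma add_eq_add_minus_diff:
  assumes "x \<in> carrier R" "y \<in> carrier R" "z \<in> carrier R"
  shows "x \<oplus> y = (z \<oplus> y) \<oplus> \<ominus> (z \<ominus> x)"
  using assms by algebra

lemma binomial_theorem:
  assumes x: "x \<in> carrier R" and y: "y \<in> carrier R"
  shows "(x \<oplus> y) [^] (n::nat) = (\<Oplus>k\<in>{..n}. [(n choose k)] \<cdot> (x [^] k \<otimes> y [^] (n - k)))"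
proof (induction n)
  case 0
  then show ?case using x y by (simp add: add.nat_pow_Suc)
next
  case (Suc n)
  let ?t = "\<lambda>N k. x [^] (k::nat) \<otimes> y [^] (N - k :: nat)"
  let ?f = "\<lambda>k. [(n choose k)] \<cdot> ?t n k"
  let ?A = "\<lambda>k. [(n choose k)] \<cdot> ?t (Suc n) (Suc k)"
  let ?B = "\<lambda>k. [(n choose k)] \<cdot> ?t (Suc n) k"
  have A: "?A \<in> {..n} \<rightarrow> carrier R" and B: "?B \<in> S \<rightarrow> carrier R" for S
    using x y by auto
  have f: "?f \<in> {..n} \<rightarrow> carrier R" using x y by auto
  have fx: "?f k \<otimes> x = ?A k" for k
    using x y by (simp add: add_pow_ldistr add_pow_rdistr m_ac)
  have fy: "?f k \<otimes> y = ?B k" if "k \<le> n" for k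
    using x y that by (simp add: add_pow_ldistr m_assoc Suc_diff_le)
  have "(x \<oplus> y) [^] Suc n = (\<Oplus>k\<in>{..n}. ?f k) \<otimes> x \<oplus> (\<Oplus>k\<in>{..n}. ?f k) \<otimes> y"
    using x y f by (simp add: Suc.IH r_distr)
  also have "(\<Oplus>k\<in>{..n}. ?f k) \<otimes> x = (\<Oplus>k\<in>{..n}. ?A k)"
    using x y f fx by (simp add: finsum_ldistr)
  also have "(\<Oplus>k\<in>{..n}. ?f k) \<otimes> y = (\<Oplus>k\<in>{..n}. ?B k)"
    unfolding finsum_ldistr[OF finite_atMost y f]
    by (rule finsum_cong') (use B fy in auto)
  \<comment> \<open>The added term has the coefficient \<open>n choose Suc n\<close>, which is 0.
    Extending the range aligns this sum with the shifted one for Pascal's rule.\<close>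
  also have "(\<Oplus>k\<in>{..n}. ?B k) = (\<Oplus>k\<in>{..Suc n}. ?B k)"
    using finsum_Suc[OF B, of n] x y by (simp add: binomial_eq_0)
  also have "\<dots> = (\<Oplus>k\<in>{..n}. ?B (Suc k)) \<oplus> ?B 0"
    by (rule finsum_Suc2[OF B])
  finally have "(x \<oplus> y) [^] Suc n = (\<Oplus>k\<in>{..n}. ?A k) \<oplus> ((\<Oplus>k\<in>{..n}. ?B (Suc k)) \<oplus> ?B 0)" .
  also have "\<dots> = (\<Oplus>k\<in>{..n}. ?A k \<oplus> ?B (Suc k)) \<oplus> ?B 0"
    using A B x y by (subst finsum_addf) (auto simp: a_assoc)
  also have "(\<Oplus>k\<in>{..n}. ?A k \<oplus> ?B (Suc k)) = (\<Oplus>k\<in>{..n}. [(Suc n choose Suc k)] \<cdot> ?t (Suc n) (Suc k))"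
    using x y by (intro finsum_cong') (auto simp: add.nat_pow_mult)
  also have "\<dots> \<oplus> ?B 0 = (\<Oplus>k\<in>{..Suc n}. [(Suc n choose k)] \<cdot> ?t (Suc n) k)"
    using x y by (subst finsum_Suc2) auto
  finally show ?case .
qed

lemma add_pow_eq_zero_of_dvd:
  assumes "[p] \<cdot> \<one> = \<zero>" "p dvd k" "x \<in> carrier R"
  shows "[(k::nat)] \<cdot> x = \<zero>"
proof -
  have "[p] \<cdot> x = ([p] \<cdot> \<one>) \<otimes> x"
    using add_pow_ldistr[OF one_closed assms(3), of p] assms(3) by simp
  hence px: "[p] \<cdot> x = \<zero>" using assms by simp
  obtain j where "k = p * j" using assms(2) by auto
  then show ?thesis
    using add.nat_pow_pow[OF assms(3), of j p] px by simp
qed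

text \<open>The prime divides every binomial coefficient except the two outer ones; writing
  \<open>p\<close> as \<open>Suc (Suc s)\<close> peels these two terms off the sum.\<close>

lemma add_pow_prime_char:
  assumes p: "prime p" and char: "[p] \<cdot> \<one> = \<zero>" and x: "x \<in> carrier R" and y: "y \<in> carrier R"
  shows "(x \<oplus> y) [^] (p::nat) = x [^] p \<oplus> y [^] p"
proof -
  obtain s where s: "p = Suc (Suc s)"
    using le_Suc_ex[OF prime_ge_2_nat[OF p]] by auto
  let ?f = "\<lambda>k. [(p choose k)] \<cdot> (x [^] k \<otimes> y [^] (p - k))"
  have f: "?f \<in> S \<rightarrow> carrier R" for S using x y by auto
  have mid: "?f k = \<zero>" if "0 < k" "k < p" for k
    by (rule add_pow_eq_zero_of_dvd[OF char]) (use p that x y in \<open>auto intro!: dvd_choose_prime\<close>)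
  have "(x \<oplus> y) [^] p = (\<Oplus>k\<in>{..Suc (Suc s)}. ?f k)"
    using binomial_theorem[OF x y, of p] s by simp
  also have "\<dots> = (\<Oplus>k\<in>{..Suc s}. ?f (Suc k)) \<oplus> ?f 0"
    by (rule finsum_Suc2[OF f])
  also have "(\<Oplus>k\<in>{..Suc s}. ?f (Suc k)) = ?f (Suc (Suc s)) \<oplus> (\<Oplus>k\<in>{..s}. ?f (Suc k))"
    by (rule finsum_Suc) (use x y in auto)
  also have "(\<Oplus>k\<in>{..s}. ?f (Suc k)) = \<zero>"
  proof (rule add.finprod_one_eqI)
    show "?f (Suc k) = \<zero>" if "k \<in> {..s}" for k
      using mid[of "Suc k"] s that by simp
  qed
  also have "?f (Suc (Suc s)) = x [^] p" using s x y by (simp add: add.nat_pow_Suc)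
  also have "?f 0 = y [^] p" using s x y by (simp add: add.nat_pow_Suc)
  finally show ?thesis using x y by simp
qed

lemma add_pow_prime_power_char:
  assumes p: "prime p" and char: "[p] \<cdot> \<one> = \<zero>" and x: "x \<in> carrier R" and y: "y \<in> carrier R"
  shows "(x \<oplus> y) [^] (p ^ n :: nat) = x [^] (p ^ n) \<oplus> y [^] (p ^ n)"
proof (induction n)
  case 0
  then show ?case using x y by simp
next
  case (Suc n)
  have "(x \<oplus> y) [^] (p ^ Suc n) = ((x \<oplus> y) [^] (p ^ n)) [^] p"
    using x y by (simp add: nat_pow_pow mult.commute)
  also have "\<dots> = (x [^] (p ^ n)) [^] p \<oplus> (y [^] (p ^ n)) [^] p"
    unfolding Suc.IH using x y by (intro add_pow_prime_char p char) auto
  finally show ?case using x y by (simp add: nat_pow_pow mult.commute)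
qed

end

text \<open>With q = p^k, the polynomial X^q - X splits with simple roots, so it has as many roots
  as its degree. Simplicity is obtained without derivatives: for a root a, additivity of Frobenius
  gives (X - a)^q = X^q - a, hence X - a = (X - a)^q - (X^q - X). If (X - a)^2 divided X^q - X, it
  would divide X - a.\<close>

lemma (in domain) card_roots_pow_minus_self:
  assumes p: "prime p" and char: "[p] \<cdot> \<one> = \<zero>" and "k > 0"
    and split: "\<And>P. P \<in> carrier (poly_ring R) \<Longrightarrow> splitted P"
  shows "card {x \<in> carrier R. x [^] (p ^ k :: nat) = x} = p ^ k"
proof -
  let ?q = "p ^ k"
  interpret UP: domain "poly_ring R"
    using univ_poly_is_domain[OF carrier_is_subring] .
  have q: "?q > 1" using prime_gt_1_nat[OF p] \<open>k > 0\<close> by (intro one_less_power)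
  interpret C: ring_hom_ring R "poly_ring R" poly_of_const
    using canonical_embedding_ring_hom[OF carrier_is_subring] by simp
  note X = var_closed(1)[OF carrier_is_subring]
  define P where "P = X [^]\<^bsub>poly_ring R\<^esub> ?q \<ominus>\<^bsub>poly_ring R\<^esub> X"
  have P: "P \<in> carrier (poly_ring R)" unfolding P_def using X by simp
  have degX: "degree X = 1" by (simp add: var_def)
  have degXq: "degree (X [^]\<^bsub>poly_ring R\<^esub> ?q) = ?q"
    using polynomial_pow_degree[OF X, of ?q] degX by simp
  have degP: "degree P = ?q"
    unfolding P_def a_minus_def univ_poly_add
    using poly_add_degree_eq[OF carrier_is_subring, of "X [^]\<^bsub>poly_ring R\<^esub> ?q" "\<ominus>\<^bsub>poly_ring R\<^esub> X"]
      univ_poly_a_inv_degree[OF carrier_is_subring X] degX degXq q X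
    by (simp add: univ_poly_carrier max_def prime_gt_Suc_0_nat[OF p] \<open>k > 0\<close> less_imp_neq[symmetric]
      del: poly_add.simps)
  have P0: "P \<noteq> []"
  proof
    assume "P = []"
    with degP prime_gt_0_nat[OF p] show False by simp
  qed
  have evalP: "eval P x = x [^] ?q \<ominus> x" if "x \<in> carrier R" for x
  proof -
    interpret ev: ring_hom_ring "poly_ring R" R "\<lambda>p. eval p x"
      by (rule eval_ring_hom[OF carrier_is_subring that])
    show ?thesis
      unfolding P_def a_minus_def using X that
      by (simp add: eval_var ev.hom_nat_pow)
  qed
  have roots: "set_mset (roots P) = {x \<in> carrier R. x [^] ?q = x}"
    using P0 evalP by (auto simp: roots_mem_iff_is_root[OF P] is_root_def)
  have charP: "[p] \<cdot>\<^bsub>poly_ring R\<^esub> \<one>\<^bsub>poly_ring R\<^esub> = \<zero>\<^bsub>poly_ring R\<^esub>"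
    using C.hom_add_pow[of "\<one>" p] char by simp
  have simple: "count (roots P) a \<le> 1" for a
  proof (rule ccontr)
    assume "\<not> count (roots P) a \<le> 1"
    then have "2 \<le> alg_mult P a" and "a \<in># roots P"
      by (auto simp: alg_mult_eq_count_roots[OF P] intro: count_inI)
    then have a: "a \<in> carrier R" "a [^] ?q = a" using roots by auto
    define T where "T = X \<oplus>\<^bsub>poly_ring R\<^esub> poly_of_const (\<ominus> a)"
    have T: "T = [\<one>, \<ominus> a]"
      using a by (simp add: T_def univ_poly_add var_def poly_of_const_def)
    have TC: "T \<in> carrier (poly_ring R)"
      using X a unfolding T_def by simp
    \<comment> \<open>Expanding this power by Frobenius yields (-a)^q = -a in every characteristic,
      without a parity case for \<open>p\<close>.\<close>
    have "\<zero> = (\<ominus> a \<oplus> a) [^] ?q"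
      using a p by (simp add: l_neg nat_pow_zero)
    also have "\<dots> = (\<ominus> a) [^] ?q \<oplus> a"
      using a add_pow_prime_power_char[OF p char, of "\<ominus> a" a k] by simp
    finally have ma: "(\<ominus> a) [^] ?q = \<ominus> a"
      using a sum_zero_eq_neg[of "(\<ominus> a) [^] ?q" a] by simp
    have "T [^]\<^bsub>poly_ring R\<^esub> ?q = X [^]\<^bsub>poly_ring R\<^esub> ?q \<oplus>\<^bsub>poly_ring R\<^esub> poly_of_const (\<ominus> a)"
      unfolding T_def using UP.add_pow_prime_power_char[OF p charP X, of "poly_of_const (\<ominus> a)" k] a ma
        C.hom_nat_pow[of "\<ominus> a" ?q] by simp
    then have TP: "T = T [^]\<^bsub>poly_ring R\<^esub> ?q \<oplus>\<^bsub>poly_ring R\<^esub> (\<ominus>\<^bsub>poly_ring R\<^esub> P)"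
      using UP.add_eq_add_minus_diff[of X "poly_of_const (\<ominus> a)" "X [^]\<^bsub>poly_ring R\<^esub> ?q"] X a
      by (simp add: T_def P_def)
    have "T [^]\<^bsub>poly_ring R\<^esub> (2::nat) pdivides P"
      unfolding T by (rule le_alg_mult_imp_pdivides[OF a(1) P \<open>2 \<le> _\<close>])
    moreover have "T [^]\<^bsub>poly_ring R\<^esub> (2::nat) pdivides T [^]\<^bsub>poly_ring R\<^esub> ?q"
      using polynomial_pow_division[OF TC, of 2 ?q] q by simp
    ultimately have "T [^]\<^bsub>poly_ring R\<^esub> (2::nat) pdivides T"
    proof -
      let ?T2 = "T [^]\<^bsub>poly_ring R\<^esub> (2::nat)"
      assume "?T2 pdivides P" "?T2 pdivides T [^]\<^bsub>poly_ring R\<^esub> ?q"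
      then obtain c d where cd: "c \<in> carrier (poly_ring R)" "P = ?T2 \<otimes>\<^bsub>poly_ring R\<^esub> c"
          "d \<in> carrier (poly_ring R)" "T [^]\<^bsub>poly_ring R\<^esub> ?q = ?T2 \<otimes>\<^bsub>poly_ring R\<^esub> d"
        unfolding pdivides_def factor_def by auto
      have "T = ?T2 \<otimes>\<^bsub>poly_ring R\<^esub> (d \<ominus>\<^bsub>poly_ring R\<^esub> c)"
        using cd TC by (subst TP) (simp add: UP.r_distr UP.r_minus a_minus_def)
      then show ?thesis
        using cd by (auto simp: pdivides_def factor_def)
    qed
    then have "degree (T [^]\<^bsub>poly_ring R\<^esub> (2::nat)) \<le> degree T"
      using pdivides_imp_degree_le[OF carrier_is_subring _ TC] TC T by simp
    then show False
      using polynomial_pow_degree[OF TC, of 2] T by simp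
  qed
  have "roots P = mset_set (set_mset (roots P))"
    by (rule multiset_eqI) (use simple in \<open>auto simp: count_mset_set' le_Suc_eq not_in_iff[symmetric]\<close>)
  then have "size (roots P) = card (set_mset (roots P))"
    by (metis size_mset_set)
  then show ?thesis
    using split[OF P] roots degP by (simp add: splitted_def)
qed

text \<open>The field is the fixed set of x -> x^(p^k) in an algebraic closure of the integers mod
  p; the element type is the one of that closure.\<close>

lemma exists_finite_field:
  assumes p: "prime p" and "k > 0"
  shows "\<exists>K :: ((int list \<times> nat) multiset \<Rightarrow> int) ring.
    field K \<and> finite (carrier K) \<and> card (carrier K) = p ^ k \<and> [p] \<cdot>\<^bsub>K\<^esub> \<one>\<^bsub>K\<^esub> = \<zero>\<^bsub>K\<^esub>"
proof -
  interpret Zp: residues_prime p "residue_ring (int p)"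
    using p by unfold_locales
  define L where "L = Zp.alg_closure"
  interpret L: algebraic_closure L "Zp.indexed_const ` carrier (residue_ring (int p))"
    unfolding L_def by (rule Zp.alg_closureE)
  interpret h: ring_hom_ring "residue_ring (int p)" L Zp.indexed_const
    by (intro ring_hom_ringI2 Zp.ring_axioms L.ring_axioms) (simp add: L_def Zp.alg_closureE)
  have "[n] \<cdot>\<^bsub>residue_ring (int p)\<^esub> \<one>\<^bsub>residue_ring (int p)\<^esub> = int n mod int p" for n :: nat
    by (induction n) (simp_all add: Zp.add.nat_pow_Suc Zp.res_add_eq Zp.res_one_eq Zp.res_zero_eq mod_simps ac_simps)
  then have char: "[p] \<cdot>\<^bsub>L\<^esub> \<one>\<^bsub>L\<^esub> = \<zero>\<^bsub>L\<^esub>"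
    using h.hom_add_pow[of "\<one>\<^bsub>residue_ring (int p)\<^esub>" p] h.hom_zero by (simp add: Zp.res_zero_eq)
  define F where "F = {x \<in> carrier L. x [^]\<^bsub>L\<^esub> (p ^ k) = x}"
  have card: "card F = p ^ k"
    unfolding F_def using L.card_roots_pow_minus_self[OF p char \<open>k > 0\<close>] L.roots_over_carrier by blast
  have subfield: "subfield F L"
  proof (rule L.subfieldI', rule L.subringI)
    show "F \<subseteq> carrier L" by (auto simp: F_def)
    show "\<one>\<^bsub>L\<^esub> \<in> F" by (simp add: F_def)
    show "h1 \<otimes>\<^bsub>L\<^esub> h2 \<in> F" if "h1 \<in> F" "h2 \<in> F" for h1 h2
      using that by (simp add: F_def L.nat_pow_distrib)
    show "h1 \<oplus>\<^bsub>L\<^esub> h2 \<in> F" if "h1 \<in> F" "h2 \<in> F" for h1 h2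
      using that by (simp add: F_def L.add_pow_prime_power_char[OF p char])
    show "\<ominus>\<^bsub>L\<^esub> h \<in> F" if "h \<in> F" for h
    proof -
      have h: "h \<in> carrier L" "h [^]\<^bsub>L\<^esub> (p ^ k) = h" using that by (auto simp: F_def)
      have "\<zero>\<^bsub>L\<^esub> = (\<ominus>\<^bsub>L\<^esub> h \<oplus>\<^bsub>L\<^esub> h) [^]\<^bsub>L\<^esub> (p ^ k)"
        using h p by (simp add: L.l_neg L.nat_pow_zero)
      also have "\<dots> = (\<ominus>\<^bsub>L\<^esub> h) [^]\<^bsub>L\<^esub> (p ^ k) \<oplus>\<^bsub>L\<^esub> h"
        using h L.add_pow_prime_power_char[OF p char, of "\<ominus>\<^bsub>L\<^esub> h" h k] by simp
      finally show ?thesis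
        using h L.sum_zero_eq_neg[of "(\<ominus>\<^bsub>L\<^esub> h) [^]\<^bsub>L\<^esub> (p ^ k)" h] by (simp add: F_def)
    qed
    show "inv\<^bsub>L\<^esub> h \<in> F" if "h \<in> F - {\<zero>\<^bsub>L\<^esub>}" for h
    proof -
      have h: "h \<in> carrier L" "h [^]\<^bsub>L\<^esub> (p ^ k) = h" "h \<in> Units L"
        using that by (auto simp: F_def L.field_Units)
      have "inv\<^bsub>L\<^esub> h [^]\<^bsub>L\<^esub> (p ^ k) \<otimes>\<^bsub>L\<^esub> h = (inv\<^bsub>L\<^esub> h \<otimes>\<^bsub>L\<^esub> h) [^]\<^bsub>L\<^esub> (p ^ k)"
        using h by (subst L.nat_pow_distrib) auto
      then have "inv\<^bsub>L\<^esub> h [^]\<^bsub>L\<^esub> (p ^ k) \<otimes>\<^bsub>L\<^esub> h = \<one>\<^bsub>L\<^esub>"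
        using h by simp
      then have "inv\<^bsub>L\<^esub> h [^]\<^bsub>L\<^esub> (p ^ k) = inv\<^bsub>L\<^esub> h"
        using h by (metis L.Units_inv_closed L.comm_inv_char L.m_comm L.nat_pow_closed)
      then show ?thesis using h by (simp add: F_def)
    qed
  qed
  let ?K = "L\<lparr>carrier := F\<rparr>"
  have "field ?K" by (rule L.subfield_iff(2)[OF subfield])
  moreover have "[p] \<cdot>\<^bsub>?K\<^esub> \<one>\<^bsub>?K\<^esub> = [p] \<cdot>\<^bsub>L\<^esub> \<one>\<^bsub>L\<^esub>"
    by (simp add: add_pow_def nat_pow_def)
  ultimately show ?thesis
    using card char prime_gt_0_nat[OF p] card_ge_0_finite[of F] by (intro exI[of _ ?K]) auto
qed

section \<open>The Hughes plane\<close>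

lemma card_eq_sum_fibres:
  assumes "finite A"
  shows "card A = (\<Sum>y\<in>f ` A. card {x \<in> A. f x = y})"
  using sum.image_gen[OF assms, of "\<lambda>_. 1::nat" f] by simp

text \<open>In the intended model $\bar x = x^m$, and \<open>sq x\<close> says that $x$ is a square, zero included.\<close>

locale conjugation_field = field R for R (structure) +
  fixes cnj :: "'a \<Rightarrow> 'a" and sq :: "'a \<Rightarrow> bool" and m :: nat
  assumes finite_carrier: "finite (carrier R)" and card_carrier: "card (carrier R) = m\<^sup>2"
    and two_nonzero: "\<one> \<oplus> \<one> \<noteq> \<zero>"
    and cnj_closed [simp]: "x \<in> carrier R \<Longrightarrow> cnj x \<in> carrier R"
    and cnj_add [simp]: "\<lbrakk>x \<in> carrier R; y \<in> carrier R\<rbrakk> \<Longrightarrow> cnj (x \<oplus> y) = cnj x \<oplus> cnj y"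
    and cnj_mult [simp]: "\<lbrakk>x \<in> carrier R; y \<in> carrier R\<rbrakk> \<Longrightarrow> cnj (x \<otimes> y) = cnj x \<otimes> cnj y"
    and cnj_cnj [simp]: "x \<in> carrier R \<Longrightarrow> cnj (cnj x) = x"
    and ex_imaginary: "\<exists>x\<in>carrier R. x \<noteq> \<zero> \<and> cnj x = \<ominus> x"
    and sq_zero [simp]: "sq \<zero>"
    and sq_mult: "\<lbrakk>x \<in> carrier R; y \<in> carrier R; x \<noteq> \<zero>; y \<noteq> \<zero>\<rbrakk> \<Longrightarrow> sq (x \<otimes> y) \<longleftrightarrow> (sq x \<longleftrightarrow> sq y)"
    and sq_cnj [simp]: "x \<in> carrier R \<Longrightarrow> sq (cnj x) \<longleftrightarrow> sq x"
    and sq_real: "\<lbrakk>x \<in> carrier R; cnj x = x\<rbrakk> \<Longrightarrow> sq x"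
    and sq_cnj_ratio: "\<lbrakk>x \<in> carrier R; e \<in> carrier R; x \<noteq> \<zero>; cnj x = e \<otimes> x\<rbrakk> \<Longrightarrow> sq e"
    and card_sq: "2 * card {x \<in> carrier R. sq x} = m\<^sup>2 + 1"
begin

lemma cnj_zero [simp]: "cnj \<zero> = \<zero>"
  using cnj_add[of \<zero> \<zero>] by (metis cnj_closed l_zero r_zero add.l_cancel_one' zero_closed)

lemma cnj_eq_zero_iff [simp]: "x \<in> carrier R \<Longrightarrow> cnj x = \<zero> \<longleftrightarrow> x = \<zero>"
  by (metis cnj_cnj cnj_zero)

lemma cnj_one [simp]: "cnj \<one> = \<one>"
  by (metis cnj_closed cnj_cnj cnj_mult l_one r_one one_closed)

lemma cnj_minus [simp]: "x \<in> carrier R \<Longrightarrow> cnj (\<ominus> x) = \<ominus> cnj x"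
  using cnj_add[of "\<ominus> x" x] sum_zero_eq_neg[of "cnj (\<ominus> x)" "cnj x"] by (simp add: l_neg)

lemma minus_self [simp]: "x \<in> carrier R \<Longrightarrow> x \<ominus> x = \<zero>"
  by (simp add: a_minus_def r_neg)

lemma mult_inv [simp]: "x \<in> carrier R \<Longrightarrow> x \<noteq> \<zero> \<Longrightarrow> x \<otimes> inv x = \<one>"
  and inv_mult [simp]: "x \<in> carrier R \<Longrightarrow> x \<noteq> \<zero> \<Longrightarrow> inv x \<otimes> x = \<one>"
  and inv_closed' [simp]: "x \<in> carrier R \<Longrightarrow> x \<noteq> \<zero> \<Longrightarrow> inv x \<in> carrier R"
  by (simp_all add: field_Units)

lemma inv_nonzero [simp]: "x \<in> carrier R \<Longrightarrow> x \<noteq> \<zero> \<Longrightarrow> inv x \<noteq> \<zero>"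
  using mult_inv r_null zero_not_one by metis

lemma mult_nonzero [simp]: "\<lbrakk>x \<in> carrier R; y \<in> carrier R; x \<noteq> \<zero>; y \<noteq> \<zero>\<rbrakk> \<Longrightarrow> x \<otimes> y \<noteq> \<zero>"
  using integral by blast

lemma cnj_inv [simp]:
  assumes "x \<in> carrier R" "x \<noteq> \<zero>"
  shows "cnj (inv x) = inv (cnj x)"
proof -
  have "cnj x \<otimes> cnj (inv x) = \<one>"
    using assms by (simp flip: cnj_mult)
  then show ?thesis
    using assms by (intro comm_inv_char[symmetric]) auto
qed

lemma sq_one [simp]: "sq \<one>"
  by (simp add: sq_real)

lemma sq_inv [simp]: "x \<in> carrier R \<Longrightarrow> x \<noteq> \<zero> \<Longrightarrow> sq (inv x) \<longleftrightarrow> sq x"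
  using sq_mult[of x "inv x"] by auto

lemma sq_norm: "x \<in> carrier R \<Longrightarrow> sq (x \<otimes> cnj x)"
  by (rule sq_real) (simp_all add: m_comm)

section \<open>Vectors, the bilinear form and proportionality\<close>

definition V :: "('a \<times> 'a \<times> 'a) set" where
  "V = carrier R \<times> carrier R \<times> carrier R"

definition zv :: "'a \<times> 'a \<times> 'a" where
  "zv = (\<zero>, \<zero>, \<zero>)"

text \<open>The coefficients 0 and 1 are fixed by conjugation. The antidiagonal shape makes (0, 0,
  1) isotropic, and for vectors (1, y, z) it makes the equation of an absolute point linear in z and
  its conjugate.\<close>

fun B :: "'a \<times> 'a \<times> 'a \<Rightarrow> 'a \<times> 'a \<times> 'a \<Rightarrow> 'a" where
  "B (a, b, c) (x, y, z) = a \<otimes> z \<oplus> b \<otimes> y \<oplus> c \<otimes> x"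

fun smul :: "'a \<Rightarrow> 'a \<times> 'a \<times> 'a \<Rightarrow> 'a \<times> 'a \<times> 'a" where
  "smul k (x, y, z) = (k \<otimes> x, k \<otimes> y, k \<otimes> z)"

fun vadd :: "'a \<times> 'a \<times> 'a \<Rightarrow> 'a \<times> 'a \<times> 'a \<Rightarrow> 'a \<times> 'a \<times> 'a" where
  "vadd (a, b, c) (x, y, z) = (a \<oplus> x, b \<oplus> y, c \<oplus> z)"

fun cj :: "'a \<times> 'a \<times> 'a \<Rightarrow> 'a \<times> 'a \<times> 'a" where
  "cj (x, y, z) = (cnj x, cnj y, cnj z)"

lemma V_iff [simp]: "(x, y, z) \<in> V \<longleftrightarrow> x \<in> carrier R \<and> y \<in> carrier R \<and> z \<in> carrier R"
  by (simp add: V_def)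

lemma V_cases:
  assumes "v \<in> V"
  obtains x y z where "v = (x, y, z)" "x \<in> carrier R" "y \<in> carrier R" "z \<in> carrier R"
  using assms by (auto simp: V_def)

lemma zv_in_V [simp]: "zv \<in> V"
  by (simp add: zv_def)

lemma smul_closed [simp]: "k \<in> carrier R \<Longrightarrow> v \<in> V \<Longrightarrow> smul k v \<in> V"
  by (erule V_cases) simp

lemma vadd_closed [simp]: "u \<in> V \<Longrightarrow> v \<in> V \<Longrightarrow> vadd u v \<in> V"
  by (elim V_cases) simp

lemma cj_closed [simp]: "v \<in> V \<Longrightarrow> cj v \<in> V"
  by (erule V_cases) simp

lemma cj_cj [simp]: "v \<in> V \<Longrightarrow> cj (cj v) = v"
  by (erule V_cases) simp

lemma cj_smul [simp]: "k \<in> carrier R \<Longrightarrow> v \<in> V \<Longrightarrow> cj (smul k v) = smul (cnj k) (cj v)"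
  by (erule V_cases) simp

lemma cj_eq_zv [simp]: "v \<in> V \<Longrightarrow> cj v = zv \<longleftrightarrow> v = zv"
  by (erule V_cases) (simp add: zv_def)

lemma smul_one [simp]: "v \<in> V \<Longrightarrow> smul \<one> v = v"
  by (erule V_cases) simp

lemma smul_smul [simp]:
  "\<lbrakk>k \<in> carrier R; l \<in> carrier R; v \<in> V\<rbrakk> \<Longrightarrow> smul k (smul l v) = smul (k \<otimes> l) v"
  by (erule V_cases) (simp add: m_assoc)

lemma smul_eq_zv [simp]: "\<lbrakk>k \<in> carrier R; v \<in> V\<rbrakk> \<Longrightarrow> smul k v = zv \<longleftrightarrow> k = \<zero> \<or> v = zv"
  by (erule V_cases) (auto simp: zv_def integral_iff)

lemma smul_cancel: "\<lbrakk>k \<in> carrier R; l \<in> carrier R; v \<in> V; v \<noteq> zv; smul k v = smul l v\<rbrakk> \<Longrightarrow> k = l"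
  by (erule V_cases) (auto simp: zv_def m_rcancel)

lemma B_closed [simp]: "u \<in> V \<Longrightarrow> v \<in> V \<Longrightarrow> B u v \<in> carrier R"
  by (elim V_cases) simp

lemma B_commute: "u \<in> V \<Longrightarrow> v \<in> V \<Longrightarrow> B u v = B v u"
  by (elim V_cases) (simp add: m_comm a_ac)

lemma B_smul_right [simp]: "\<lbrakk>k \<in> carrier R; u \<in> V; v \<in> V\<rbrakk> \<Longrightarrow> B u (smul k v) = k \<otimes> B u v"
  by (elim V_cases) (simp add: m_lcomm r_distr)

lemma B_smul_left [simp]: "\<lbrakk>k \<in> carrier R; u \<in> V; v \<in> V\<rbrakk> \<Longrightarrow> B (smul k u) v = k \<otimes> B u v"
  by (elim V_cases) (simp add: m_assoc r_distr)

lemma B_vadd_right [simp]: "\<lbrakk>u \<in> V; v \<in> V; w \<in> V\<rbrakk> \<Longrightarrow> B u (vadd v w) = B u v \<oplus> B u w"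
  by (elim V_cases) (simp add: r_distr a_ac)

lemma B_cj_cj [simp]: "u \<in> V \<Longrightarrow> v \<in> V \<Longrightarrow> B (cj u) (cj v) = cnj (B u v)"
  by (elim V_cases) simp

lemma B_cj_right: "u \<in> V \<Longrightarrow> v \<in> V \<Longrightarrow> B u (cj v) = cnj (B (cj u) v)"
  using B_cj_cj[of "cj u" v] by simp

lemma B_zv [simp]: "u \<in> V \<Longrightarrow> B u zv = \<zero>"
  by (elim V_cases) (simp add: zv_def)

lemma B_nondegenerate:
  assumes "u \<in> V" "u \<noteq> zv"
  shows "\<exists>v\<in>V. B u v \<noteq> \<zero>"
proof -
  obtain a b c where u: "u = (a, b, c)" "a \<in> carrier R" "b \<in> carrier R" "c \<in> carrier R"
    using assms(1) by (rule V_cases)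
  have "B u (\<one>, \<zero>, \<zero>) = c" "B u (\<zero>, \<one>, \<zero>) = b" "B u (\<zero>, \<zero>, \<one>) = a"
    using u by simp_all
  moreover have "(\<one>, \<zero>, \<zero>) \<in> V" "(\<zero>, \<one>, \<zero>) \<in> V" "(\<zero>, \<zero>, \<one>) \<in> V" by simp_all
  moreover have "a \<noteq> \<zero> \<or> b \<noteq> \<zero> \<or> c \<noteq> \<zero>" using assms(2) u by (auto simp: zv_def)
  ultimately show ?thesis by metis
qed

text \<open>Not symmetric: \<open>c\<close> may be zero, so every vector is parallel to
  \<open>zv\<close>, while \<open>zv\<close> is parallel only to itself. Hence the nonzero
  hypotheses in later lemmas.\<close>

definition par :: "'a \<times> 'a \<times> 'a \<Rightarrow> 'a \<times> 'a \<times> 'a \<Rightarrow> bool" where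
  "par v w \<longleftrightarrow> (\<exists>c\<in>carrier R. w = smul c v)"

lemma solve_ratio:
  assumes "x \<in> carrier R" "y \<in> carrier R" "x' \<in> carrier R" "y' \<in> carrier R" "x \<noteq> \<zero>"
    and eq: "x \<otimes> y' = y \<otimes> x'"
  shows "y' = (x' \<otimes> inv x) \<otimes> y"
proof -
  have "(x' \<otimes> inv x) \<otimes> y = inv x \<otimes> (y \<otimes> x')"
    using assms(1-5) by (simp add: m_ac)
  also have "\<dots> = (inv x \<otimes> x) \<otimes> y'"
    unfolding eq[symmetric] using assms(1-5) by (subst m_assoc) auto
  finally show ?thesis using assms(1-5) by simp
qed

lemma par_of_minors:
  assumes "x \<in> carrier R" "y \<in> carrier R" "z \<in> carrier R"
    and "x' \<in> carrier R" "y' \<in> carrier R" "z' \<in> carrier R"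
    and nz: "(x, y, z) \<noteq> zv"
    and xy: "x \<otimes> y' = y \<otimes> x'" and xz: "x \<otimes> z' = z \<otimes> x'" and yz: "y \<otimes> z' = z \<otimes> y'"
  shows "par (x, y, z) (x', y', z')"
proof -
  note c = assms(1-6)
  consider "x \<noteq> \<zero>" | "y \<noteq> \<zero>" | "z \<noteq> \<zero>" using nz by (auto simp: zv_def)
  then show ?thesis
  proof cases
    case 1
    then show ?thesis
      unfolding par_def using c solve_ratio[OF c(1,2,4,5) 1 xy] solve_ratio[OF c(1,3,4,6) 1 xz]
      by (intro bexI[of _ "x' \<otimes> inv x"]) (auto simp: m_assoc)
  next
    case 2
    have yx: "y \<otimes> x' = x \<otimes> y'" using xy by simp
    show ?thesis
      unfolding par_def using c solve_ratio[OF c(2,1,5,4) 2 yx] solve_ratio[OF c(2,3,5,6) 2 yz] 2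
      by (intro bexI[of _ "y' \<otimes> inv y"]) (auto simp: m_assoc)
  next
    case 3
    have zx: "z \<otimes> x' = x \<otimes> z'" and zy: "z \<otimes> y' = y \<otimes> z'" using xz yz by simp_all
    show ?thesis
      unfolding par_def using c solve_ratio[OF c(3,1,6,4) 3 zx] solve_ratio[OF c(3,2,6,5) 3 zy] 3
      by (intro bexI[of _ "z' \<otimes> inv z"]) (auto simp: m_assoc)
  qed
qed

text \<open>Up to sign the usual cross product with its coordinates reversed; the reversal matches
  the antidiagonal form \<open>B\<close> in place of the dot product.\<close>

fun cross :: "'a \<times> 'a \<times> 'a \<Rightarrow> 'a \<times> 'a \<times> 'a \<Rightarrow> 'a \<times> 'a \<times> 'a" where
  "cross (a, b, c) (x, y, z) = (b \<otimes> x \<ominus> a \<otimes> y, a \<otimes> z \<ominus> c \<otimes> x, c \<otimes> y \<ominus> b \<otimes> z)"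

lemma cross_closed [simp]: "u \<in> V \<Longrightarrow> v \<in> V \<Longrightarrow> cross u v \<in> V"
  by (elim V_cases) simp

lemma B_cross:
  assumes "u \<in> V" "v \<in> V"
  shows "B u (cross u v) = \<zero>" "B v (cross u v) = \<zero>"
proof -
  have *: "a \<otimes> (c \<otimes> y \<ominus> b \<otimes> z) \<oplus> b \<otimes> (a \<otimes> z \<ominus> c \<otimes> x) \<oplus> c \<otimes> (b \<otimes> x \<ominus> a \<otimes> y) = \<zero>"
    "x \<otimes> (c \<otimes> y \<ominus> b \<otimes> z) \<oplus> y \<otimes> (a \<otimes> z \<ominus> c \<otimes> x) \<oplus> z \<otimes> (b \<otimes> x \<ominus> a \<otimes> y) = \<zero>"
    if "a \<in> carrier R" "b \<in> carrier R" "c \<in> carrier R" "x \<in> carrier R" "y \<in> carrier R" "z \<in> carrier R"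
    for a b c x y z
    using that by algebra+
  show "B u (cross u v) = \<zero>" "B v (cross u v) = \<zero>"
    using assms by (elim V_cases; simp add: *)+
qed

lemma cross_eq_zv_imp_par:
  assumes "u \<in> V" "v \<in> V" "u \<noteq> zv" "cross u v = zv"
  shows "par u v"
proof -
  obtain a b c where u: "u = (a, b, c)" "a \<in> carrier R" "b \<in> carrier R" "c \<in> carrier R"
    using assms(1) by (rule V_cases)
  obtain x y z where v: "v = (x, y, z)" "x \<in> carrier R" "y \<in> carrier R" "z \<in> carrier R"
    using assms(2) by (rule V_cases)
  have "b \<otimes> x = a \<otimes> y" "a \<otimes> z = c \<otimes> x" "c \<otimes> y = b \<otimes> z"
    using assms(4) u v by (simp_all add: zv_def)
  then show ?thesis
    unfolding u(1) v(1) using u v assms(3) by (intro par_of_minors) auto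
qed

text \<open>As in the double cross product identity, the 2 by 2 minors of \<open>cross u v\<close>
  and \<open>w\<close> are combinations of \<open>B u w\<close> and \<open>B v w\<close>, so they
  vanish.\<close>

lemma orthogonal_imp_par_cross:
  assumes "u \<in> V" "v \<in> V" "w \<in> V" "cross u v \<noteq> zv" "B u w = \<zero>" "B v w = \<zero>"
  shows "par (cross u v) w"
proof -
  obtain a b c where u: "u = (a, b, c)" "a \<in> carrier R" "b \<in> carrier R" "c \<in> carrier R"
    using assms(1) by (rule V_cases)
  obtain x y z where v: "v = (x, y, z)" "x \<in> carrier R" "y \<in> carrier R" "z \<in> carrier R"
    using assms(2) by (rule V_cases)
  obtain r s t where w: "w = (r, s, t)" "r \<in> carrier R" "s \<in> carrier R" "t \<in> carrier R"
    using assms(3) by (rule V_cases)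
  note C = u(2-4) v(2-4) w(2-4)
  have 1: "(b \<otimes> x \<ominus> a \<otimes> y) \<otimes> s \<ominus> (a \<otimes> z \<ominus> c \<otimes> x) \<otimes> r = x \<otimes> B u w \<ominus> a \<otimes> B v w"
    using C unfolding u(1) v(1) w(1) B.simps by algebra
  have 2: "(b \<otimes> x \<ominus> a \<otimes> y) \<otimes> t \<ominus> (c \<otimes> y \<ominus> b \<otimes> z) \<otimes> r = b \<otimes> B v w \<ominus> y \<otimes> B u w"
    using C unfolding u(1) v(1) w(1) B.simps by algebra
  have 3: "(a \<otimes> z \<ominus> c \<otimes> x) \<otimes> t \<ominus> (c \<otimes> y \<ominus> b \<otimes> z) \<otimes> s = z \<otimes> B u w \<ominus> c \<otimes> B v w"
    using C unfolding u(1) v(1) w(1) B.simps by algebra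
  have D: "b \<otimes> x \<ominus> a \<otimes> y \<in> carrier R" "a \<otimes> z \<ominus> c \<otimes> x \<in> carrier R" "c \<otimes> y \<ominus> b \<otimes> z \<in> carrier R"
    using C by auto
  show ?thesis
    unfolding u(1) v(1) w(1) cross.simps
  proof (rule par_of_minors[OF D w(2-4)])
    show "(b \<otimes> x \<ominus> a \<otimes> y, a \<otimes> z \<ominus> c \<otimes> x, c \<otimes> y \<ominus> b \<otimes> z) \<noteq> zv"
      using assms(4) u(1) v(1) by simp
  qed (use 1 2 3 C D assms(5,6) in \<open>simp_all add: a_minus_def[of R \<zero> \<zero>]\<close>)
qed

lemma orthogonal_imp_par:
  assumes "a \<in> V" "b \<in> V" "v \<in> V" "w \<in> V" "a \<noteq> zv" "v \<noteq> zv" "\<not> par a b"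
    and "B a v = \<zero>" "B b v = \<zero>" "B a w = \<zero>" "B b w = \<zero>"
  shows "par v w"
proof -
  have c: "cross a b \<noteq> zv" using cross_eq_zv_imp_par assms by blast
  obtain k where k: "k \<in> carrier R" "v = smul k (cross a b)"
    using orthogonal_imp_par_cross[of a b v] c assms unfolding par_def by blast
  obtain l where l: "l \<in> carrier R" "w = smul l (cross a b)"
    using orthogonal_imp_par_cross[of a b w] c assms unfolding par_def by blast
  have "k \<noteq> \<zero>" using assms k by auto
  then have "w = smul (l \<otimes> inv k) v"
    using k l assms by (simp add: m_assoc)
  then show ?thesis
    unfolding par_def using k(1) l(1) \<open>k \<noteq> \<zero>\<close> by (intro bexI[of _ "l \<otimes> inv k"]) simp_all
qed

section \<open>Nearfield multiplications and incidence\<close>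

definition act :: "'a \<Rightarrow> 'a \<times> 'a \<times> 'a \<Rightarrow> 'a \<times> 'a \<times> 'a" where
  "act k v = (if sq k then smul k v else smul k (cj v))"

definition sim :: "'a \<times> 'a \<times> 'a \<Rightarrow> 'a \<times> 'a \<times> 'a \<Rightarrow> bool" where
  "sim v w \<longleftrightarrow> (\<exists>k\<in>carrier R - {\<zero>}. w = act k v)"

text \<open>The alternatives stand for x -> k x with k a square and for x -> k conj(x) with k a
  nonsquare. Since \<open>sq \<zero>\<close> holds, the zero map belongs to the first, and the two
  exclude each other.\<close>

definition J :: "'a \<times> 'a \<times> 'a \<Rightarrow> 'a \<times> 'a \<times> 'a \<Rightarrow> bool" where
  "J u v \<longleftrightarrow> (B (cj u) v = \<zero> \<and> sq (B u v)) \<or> (B u v = \<zero> \<and> \<not> sq (B (cj u) v))"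

lemma act_closed [simp]: "k \<in> carrier R \<Longrightarrow> v \<in> V \<Longrightarrow> act k v \<in> V"
  by (simp add: act_def)

lemma act_eq_zv [simp]: "k \<in> carrier R \<Longrightarrow> v \<in> V \<Longrightarrow> act k v = zv \<longleftrightarrow> k = \<zero> \<or> v = zv"
  by (simp add: act_def)

lemma act_one [simp]: "v \<in> V \<Longrightarrow> act \<one> v = v"
  by (simp add: act_def)

text \<open>This is the nearfield product: a nonsquare \<open>l\<close> conjugates the factor to its
  right. The product stays in the family because conjugation preserves \<open>sq\<close> and two
  nonsquares multiply to a square.\<close>

lemma act_act:
  assumes "k \<in> carrier R - {\<zero>}" "l \<in> carrier R - {\<zero>}" "v \<in> V"
  shows "act l (act k v) = act (l \<otimes> (if sq l then k else cnj k)) v"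
  using assms sq_mult[of l k] sq_mult[of l "cnj k"] by (simp add: act_def)

lemma sim_refl: "v \<in> V \<Longrightarrow> sim v v"
  unfolding sim_def by (rule bexI[of _ \<one>]) auto

lemma sim_trans:
  assumes "v \<in> V" "sim v w" "sim w x"
  shows "sim v x"
proof -
  obtain k l where "k \<in> carrier R - {\<zero>}" "l \<in> carrier R - {\<zero>}" "x = act l (act k v)"
    using assms unfolding sim_def by auto
  then show ?thesis
    unfolding sim_def using act_act[of k l v] assms(1)
    by (intro bexI[of _ "l \<otimes> (if sq l then k else cnj k)"]) auto
qed

lemma sim_sym:
  assumes "v \<in> V" "sim v w"
  shows "sim w v"
proof -
  obtain k where k: "k \<in> carrier R - {\<zero>}" "w = act k v"
    using assms unfolding sim_def by auto
  \<comment> \<open>For nonsquare \<open>k\<close> the element \<open>l\<close> is a nonsquare too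
    and conjugates \<open>k\<close> in the product, so the inverse of \<open>cnj k\<close> is
    needed.\<close>
  define l where "l = inv (if sq k then k else cnj k)"
  have l: "l \<in> carrier R - {\<zero>}" "l \<otimes> (if sq l then k else cnj k) = \<one>"
    using k by (auto simp: l_def)
  have "v = act l w"
    using act_act[OF k(1) l(1) assms(1)] l k assms(1) by simp
  then show ?thesis unfolding sim_def using l by blast
qed

lemma sim_closed: "v \<in> V \<Longrightarrow> sim v w \<Longrightarrow> w \<in> V"
  by (auto simp: sim_def)

lemma sim_nonzero: "v \<in> V \<Longrightarrow> v \<noteq> zv \<Longrightarrow> sim v w \<Longrightarrow> w \<noteq> zv"
  by (auto simp: sim_def)

lemma sq_mult_nonzero_left:
  "\<lbrakk>k \<in> carrier R; k \<noteq> \<zero>; x \<in> carrier R\<rbrakk> \<Longrightarrow> sq (k \<otimes> x) \<longleftrightarrow> x = \<zero> \<or> (sq k \<longleftrightarrow> sq x)"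
  by (cases "x = \<zero>") (auto simp: sq_mult)

lemma J_commute:
  assumes "u \<in> V" "v \<in> V"
  shows "J u v \<longleftrightarrow> J v u"
proof -
  have "B (cj u) v = cnj (B (cj v) u)"
    using assms B_commute[of "cj u" v] B_cj_right[of v u] by simp
  then show ?thesis
    unfolding J_def using assms B_commute[of u v] by simp
qed

text \<open>A nonsquare \<open>k\<close> replaces \<open>v\<close> by a multiple of
  \<open>cj v\<close>, which exchanges the two values in \<open>J\<close>, and it exchanges squares
  and nonsquares among nonzero values; so the alternatives are swapped. If both values vanish, the
  first alternative persists.\<close>

lemma J_act:
  assumes "u \<in> V" "v \<in> V" "k \<in> carrier R - {\<zero>}"
  shows "J u (act k v) \<longleftrightarrow> J u v"
proof (cases "sq k")
  case True
  then show ?thesis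
    using assms by (simp add: J_def act_def integral_iff sq_mult_nonzero_left) metis
next
  case False
  have "B (cj u) (cj v) = cnj (B u v)" "B u (cj v) = cnj (B (cj u) v)"
    using assms by (simp_all add: B_cj_right)
  then show ?thesis
    using assms False by (simp add: J_def act_def integral_iff sq_mult_nonzero_left) metis
qed

lemma J_sim: "u \<in> V \<Longrightarrow> v \<in> V \<Longrightarrow> sim v w \<Longrightarrow> J u w \<longleftrightarrow> J u v"
  by (auto simp: sim_def J_act)

text \<open>An incidence of the second kind with nonsquare value k = \<open>B (cj u) v\<close>
  becomes one of the first kind when \<open>v\<close> is replaced by \<open>act k v\<close>: the new
  value is the norm \<open>k \<otimes> cnj k\<close>, an element of F and so a square.\<close>

lemma J_normalise:
  assumes "u \<in> V" "v \<in> V" "J u v"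
  obtains w where "sim v w" "B (cj u) w = \<zero>" "sq (B u w)"
proof (cases "B (cj u) v = \<zero> \<and> sq (B u v)")
  case True
  then show ?thesis using that[of v] sim_refl[OF assms(2)] by blast
next
  case False
  define k where "k = B (cj u) v"
  have k: "B u v = \<zero>" "\<not> sq k" "k \<in> carrier R"
    using assms False by (auto simp: J_def k_def)
  then have "k \<noteq> \<zero>" by auto
  have "sim v (act k v)"
    unfolding sim_def using k \<open>k \<noteq> \<zero>\<close> by blast
  moreover have "B (cj u) (act k v) = \<zero>"
    using assms k by (simp add: act_def)
  moreover have "B u (act k v) = k \<otimes> cnj k"
    using assms k by (simp add: act_def B_cj_right k_def)
  ultimately show ?thesis
    using that[of "act k v"] sq_norm[OF k(3)] by simp
qed

section \<open>Uniqueness of joins\<close>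

lemma sq_self_conjugate:
  assumes "u \<in> V" "u \<noteq> zv" "d \<in> carrier R" "u = smul d (cj u)"
  shows "sq d"
proof -
  have "cj u = smul (cnj d) u"
    using assms cj_smul[of d "cj u"] by simp
  moreover obtain a b c where u: "u = (a, b, c)" "a \<in> carrier R" "b \<in> carrier R" "c \<in> carrier R"
    using assms(1) by (rule V_cases)
  moreover have "a \<noteq> \<zero> \<or> b \<noteq> \<zero> \<or> c \<noteq> \<zero>" using assms(2) u by (auto simp: zv_def)
  \<comment> \<open>A nonzero coordinate a satisfies conj(a) = conj(d) a, so
    \<open>sq_cnj_ratio\<close> applies to it.\<close>
  ultimately have "sq (cnj d)"
    using sq_cnj_ratio[of a "cnj d"] sq_cnj_ratio[of b "cnj d"] sq_cnj_ratio[of c "cnj d"] assms(3) by auto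
  then show ?thesis using assms(3) by simp
qed

text \<open>A vector proportional to its conjugate represents a point of the subplane over F. There
  the twist is invisible: for nonsquare c, writing u = d \<open>cj u\<close> with d a square, c u =
  (c d) \<open>cj u\<close> is again a nearfield multiple.\<close>

lemma sim_of_self_conjugate:
  assumes u: "u \<in> V" "u \<noteq> zv" "par (cj u) u" and w: "par u w" "w \<noteq> zv"
  shows "sim u w"
proof -
  obtain d where d: "d \<in> carrier R" "u = smul d (cj u)" using u by (auto simp: par_def)
  obtain c where c: "c \<in> carrier R" "w = smul c u" using w by (auto simp: par_def)
  have "sq d" by (rule sq_self_conjugate[OF u(1,2) d])
  have "d \<noteq> \<zero>" using d u(1,2) smul_eq_zv[of d "cj u"] by auto
  have "c \<noteq> \<zero>" using c u w by auto
  show ?thesis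
  proof (cases "sq c")
    case True
    then show ?thesis unfolding sim_def using c \<open>c \<noteq> \<zero>\<close>
      by (intro bexI[of _ c]) (auto simp: act_def)
  next
    case False
    have "w = smul (c \<otimes> d) (cj u)" using c d u by (metis cj_closed smul_smul)
    moreover have "\<not> sq (c \<otimes> d)" using sq_mult[of c d] False \<open>sq d\<close> \<open>d \<noteq> \<zero>\<close> \<open>c \<noteq> \<zero>\<close> c d by simp
    ultimately show ?thesis unfolding sim_def using c d \<open>d \<noteq> \<zero>\<close> \<open>c \<noteq> \<zero>\<close>
      by (intro bexI[of _ "c \<otimes> d"]) (auto simp: act_def)
  qed
qed

lemma par_cj: "u \<in> V \<Longrightarrow> v \<in> V \<Longrightarrow> par (cj u) (cj v) \<Longrightarrow> par u v"
proof -
  assume "u \<in> V" "v \<in> V" "par (cj u) (cj v)"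
  then obtain c where c: "c \<in> carrier R" "cj v = smul c (cj u)" by (auto simp: par_def)
  have "cj (cj v) = cj (smul c (cj u))" using c(2) by (rule arg_cong)
  then have "v = smul (cnj c) u" using \<open>u \<in> V\<close> \<open>v \<in> V\<close> c(1) by simp
  then show "par u v" unfolding par_def using c(1) by (intro bexI[of _ "cnj c"]) simp_all
qed

text \<open>For lines \<open>u\<close>, \<open>u'\<close> through points \<open>v\<close>, \<open>w\<close>, suitable representatives bring three of the
  four incidences into the first case in the definition of \<open>J\<close>. The fourth one may then be of
  either type.\<close>

lemma join_unique_same_type:
  assumes "u \<in> V" "u' \<in> V" "v \<in> V" "w \<in> V" "u \<noteq> zv" "u' \<noteq> zv" "v \<noteq> zv" "w \<noteq> zv"
    and uv: "B (cj u) v = \<zero>" "sq (B u v)" and uw: "B (cj u) w = \<zero>" "sq (B u w)"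
    and u'v: "B (cj u') v = \<zero>" "sq (B u' v)" and u'w: "B (cj u') w = \<zero>" "sq (B u' w)"
  shows "sim v w \<or> sim u u'"
proof (cases "par v w")
  case False
  have comm: "B v (cj u) = \<zero>" "B w (cj u) = \<zero>" "B v (cj u') = \<zero>" "B w (cj u') = \<zero>"
    using assms B_commute cj_closed by metis+
  have "par (cj u) (cj u')"
    by (rule orthogonal_imp_par[of v w]) (use assms False comm in auto)
  then have par: "par u u'" using assms par_cj by blast
  then obtain c where c: "c \<in> carrier R" "u' = smul c u" by (auto simp: par_def)
  have "c \<noteq> \<zero>" using c assms by auto
  show ?thesis
  \<comment> \<open>If some value is nonzero, \<open>c\<close> is a quotient of two nonzero squares.
    If both vanish, \<open>u\<close> is orthogonal to \<open>v\<close> and \<open>w\<close> just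
    like \<open>cj u\<close>, so it is self-conjugate and any nonzero \<open>c\<close> will
    do.\<close>
  proof (cases "B u v = \<zero> \<and> B u w = \<zero>")
    case True
    have "par (cj u) u"
      by (rule orthogonal_imp_par[of v w])
        (use assms False comm True B_commute[of u v] B_commute[of u w] in auto)
    then show ?thesis using sim_of_self_conjugate par assms by blast
  next
    case nz: False
    have "sq c"
      using sq_mult[of c "B u v"] sq_mult[of c "B u w"] nz u'v u'w uv uw c \<open>c \<noteq> \<zero>\<close> assms(1,3,4) by auto
    then have "sim u u'" unfolding sim_def using c \<open>c \<noteq> \<zero>\<close>
      by (intro bexI[of _ c]) (auto simp: act_def)
    then show ?thesis ..
  qed
next
  case True
  then obtain c where c: "c \<in> carrier R" "w = smul c v" by (auto simp: par_def)
  have "c \<noteq> \<zero>" using c assms by auto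
  show ?thesis
  proof (cases "sq c \<or> par (cj v) v")
    case True
    have "sim v w" if "sq c"
      unfolding sim_def using c \<open>c \<noteq> \<zero>\<close> that by (intro bexI[of _ c]) (auto simp: act_def)
    then show ?thesis
      using True sim_of_self_conjugate[of v w] assms(3,7,8) \<open>par v w\<close> by blast
  next
    case False
    \<comment> \<open>A nonzero \<open>B u v\<close> and its multiple by the nonsquare
      \<open>c\<close>, which is \<open>B u w\<close>, cannot both be squares; likewise for
      \<open>u'\<close>. So \<open>u\<close>, \<open>cj u\<close> and \<open>u'\<close> are all
      orthogonal to the independent vectors \<open>v\<close> and \<open>cj v\<close>.\<close>
    have z: "B u v = \<zero>" "B u' v = \<zero>"
      using sq_mult[of c "B u v"] sq_mult[of c "B u' v"] u'v u'w uv uw c \<open>c \<noteq> \<zero>\<close> False assms(1-4) by auto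
    have orth1: "B v x = \<zero>" "B (cj v) x = \<zero>" if "x \<in> V" "B x v = \<zero>" "B (cj x) v = \<zero>" for x
      using that assms(3) by (simp_all add: B_commute[of v x] B_commute[of "cj v" x] B_cj_right)
    have "B v (cj u) = \<zero>" "B (cj v) (cj u) = \<zero>"
      using orth1[of "cj u"] assms(1) uv(1) z(1) by simp_all
    note orth = this orth1[OF assms(1) z(1) uv(1)] orth1[OF assms(2) z(2) u'v(1)]
    have "par (cj u) u"
      by (rule orthogonal_imp_par[of "cj v" v]) (use assms False orth z in auto)
    moreover have "par u u'"
      by (rule orthogonal_imp_par[of "cj v" v]) (use assms False orth z in auto)
    ultimately show ?thesis using sim_of_self_conjugate assms by blast
  qed
qed

section \<open>The fixed field and joins of mixed type\<close>

definition half :: 'a where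
  "half = inv (\<one> \<oplus> \<one>)"

lemma half_closed [simp]: "half \<in> carrier R"
  and cnj_half [simp]: "cnj half = half"
  and half_add_half: "half \<oplus> half = \<one>"
proof -
  have "(\<one> \<oplus> \<one>) \<otimes> half = \<one>" using two_nonzero by (simp add: half_def)
  moreover show "half \<in> carrier R" "cnj half = half" using two_nonzero by (simp_all add: half_def)
  ultimately show "half \<oplus> half = \<one>" by (simp add: l_distr)
qed

lemma cnj_diff [simp]: "\<lbrakk>x \<in> carrier R; y \<in> carrier R\<rbrakk> \<Longrightarrow> cnj (x \<ominus> y) = cnj x \<ominus> cnj y"
  by (simp add: a_minus_def)

lemma inv_minus: "x \<in> carrier R \<Longrightarrow> x \<noteq> \<zero> \<Longrightarrow> inv (\<ominus> x) = \<ominus> (inv x)"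
  by (intro comm_inv_char) (auto simp: l_minus r_minus)

text \<open>A nonzero \<open>l\<close> with \<open>cnj l = \<ominus> l\<close> splits K as the
  direct sum of F and l F, so the square of the order of F is m^2.\<close>

lemma card_real: "card {x \<in> carrier R. cnj x = x} = m"
proof -
  obtain l where l: "l \<in> carrier R" "l \<noteq> \<zero>" "cnj l = \<ominus> l" using ex_imaginary by blast
  let ?F = "{x \<in> carrier R. cnj x = x}"
  define h where "h = half"
  have h: "h \<in> carrier R" "cnj h = h" "h \<oplus> h = \<one>"
    by (simp_all add: h_def half_add_half)
  have "bij_betw (\<lambda>(r, s). r \<oplus> l \<otimes> s) (?F \<times> ?F) (carrier R)"
  proof (rule bij_betw_byWitness[where f' = "\<lambda>x. (h \<otimes> (x \<oplus> cnj x), h \<otimes> ((x \<ominus> cnj x) \<otimes> inv l))"])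
    have *: "h \<otimes> ((r \<oplus> l \<otimes> s) \<oplus> (r \<oplus> (\<ominus> l) \<otimes> s)) = (h \<oplus> h) \<otimes> r"
      "h \<otimes> (((r \<oplus> l \<otimes> s) \<ominus> (r \<oplus> (\<ominus> l) \<otimes> s)) \<otimes> k) = (h \<oplus> h) \<otimes> (s \<otimes> (l \<otimes> k))"
      if "r \<in> carrier R" "s \<in> carrier R" "k \<in> carrier R" for r s k
      using that h(1) l(1) by algebra+
    show "\<forall>a\<in>?F \<times> ?F. (\<lambda>x. (h \<otimes> (x \<oplus> cnj x), h \<otimes> ((x \<ominus> cnj x) \<otimes> inv l))) ((\<lambda>(r, s). r \<oplus> l \<otimes> s) a) = a"
      using l h * by auto
    have **: "h \<otimes> (x \<oplus> y) \<oplus> l \<otimes> (h \<otimes> ((x \<ominus> y) \<otimes> k)) = h \<otimes> (x \<oplus> y) \<oplus> h \<otimes> ((x \<ominus> y) \<otimes> (l \<otimes> k))"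
      "h \<otimes> (x \<oplus> y) \<oplus> h \<otimes> (x \<ominus> y) = (h \<oplus> h) \<otimes> x"
      if "x \<in> carrier R" "y \<in> carrier R" "k \<in> carrier R" for x y k
      using that h(1) l(1) by algebra+
    show "\<forall>x\<in>carrier R. (\<lambda>(r, s). r \<oplus> l \<otimes> s) (h \<otimes> (x \<oplus> cnj x), h \<otimes> ((x \<ominus> cnj x) \<otimes> inv l)) = x"
      using l h **[of _ "cnj _" "inv l"] by auto
    show "(\<lambda>(r, s). r \<oplus> l \<otimes> s) ` (?F \<times> ?F) \<subseteq> carrier R"
      using l by auto
    have "cnj ((x \<ominus> cnj x) \<otimes> inv l) = (x \<ominus> cnj x) \<otimes> inv l" if x: "x \<in> carrier R" for x
    proof -
      have "(cnj x \<ominus> x) \<otimes> (\<ominus> k) = (x \<ominus> cnj x) \<otimes> k" if "k \<in> carrier R" for k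
        using that x cnj_closed[OF x] by algebra
      then show ?thesis using l x by (simp add: inv_minus)
    qed
    then show "(\<lambda>x. (h \<otimes> (x \<oplus> cnj x), h \<otimes> ((x \<ominus> cnj x) \<otimes> inv l))) ` carrier R \<subseteq> ?F \<times> ?F"
      using l h by (auto simp: a_comm)
  qed
  then have "card (?F \<times> ?F) = card (carrier R)"
    by (rule bij_betw_same_card)
  then have "(card ?F)\<^sup>2 = m\<^sup>2"
    by (simp add: card_cartesian_product card_carrier power2_eq_square)
  then show ?thesis
    by (rule power2_eq_imp_eq) auto
qed

lemma m_ge_2: "m \<ge> 2"
proof -
  have "card {\<zero>, \<one>} \<le> card (carrier R)"
    by (rule card_mono) (auto simp: finite_carrier)
  then have "2 \<le> m\<^sup>2" by (simp add: card_carrier)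
  then show ?thesis by (cases "m = 0 \<or> m = 1") auto
qed

text \<open>Pigeonhole: the pairs $(x, y)$ form a space of dimension 4 over the fixed field, and the
  self-conjugate vectors one of dimension 3.\<close>

lemma ex_trace_relation:
  assumes v: "v \<in> V" and w: "w \<in> V"
  obtains x y where "x \<in> carrier R" "y \<in> carrier R" "x \<noteq> \<zero> \<or> y \<noteq> \<zero>"
    "vadd (smul x v) (smul (cnj x) (cj v)) = vadd (smul y w) (smul (cnj y) (cj w))"
proof -
  let ?F = "{x \<in> carrier R. cnj x = x}"
  let ?C = "carrier R \<times> carrier R"
  define g where "g = (\<lambda>(x, y). vadd (vadd (smul x v) (smul (cnj x) (cj v))) (vadd (smul y w) (smul (cnj y) (cj w))))"
  obtain a b c where v': "v = (a, b, c)" "a \<in> carrier R" "b \<in> carrier R" "c \<in> carrier R"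
    using v by (rule V_cases)
  obtain a' b' c' where w': "w = (a', b', c')" "a' \<in> carrier R" "b' \<in> carrier R" "c' \<in> carrier R"
    using w by (rule V_cases)
  have "g ` ?C \<subseteq> ?F \<times> ?F \<times> ?F"
    using v' w' by (auto simp: g_def a_comm)
  then have "card (g ` ?C) \<le> card (?F \<times> ?F \<times> ?F)"
    by (intro card_mono) (simp_all add: finite_carrier)
  also have "\<dots> = m ^ 3"
    by (simp add: card_cartesian_product card_real power3_eq_cube)
  also have "\<dots> < m ^ 4"
    using m_ge_2 by (intro power_strict_increasing) auto
  also have "\<dots> = card ?C"
    by (simp add: card_cartesian_product card_carrier flip: power_add)
  finally have "\<not> inj_on g ?C"
    using card_image by fastforce
  then obtain x1 y1 x2 y2 where xy: "x1 \<in> carrier R" "y1 \<in> carrier R" "x2 \<in> carrier R" "y2 \<in> carrier R"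
    "(x1, y1) \<noteq> (x2, y2)" "g (x1, y1) = g (x2, y2)"
    by (auto simp: inj_on_def)
  have shift: "(x1 \<ominus> x2) \<otimes> s \<oplus> cnj (x1 \<ominus> x2) \<otimes> cnj s = (y2 \<ominus> y1) \<otimes> t \<oplus> cnj (y2 \<ominus> y1) \<otimes> cnj t"
    if s: "s \<in> carrier R" and t: "t \<in> carrier R"
      and eq: "x1 \<otimes> s \<oplus> cnj x1 \<otimes> cnj s \<oplus> (y1 \<otimes> t \<oplus> cnj y1 \<otimes> cnj t)
        = x2 \<otimes> s \<oplus> cnj x2 \<otimes> cnj s \<oplus> (y2 \<otimes> t \<oplus> cnj y2 \<otimes> cnj t)" for s t
  proof -
    have *: "((x1 \<ominus> x2) \<otimes> s \<oplus> (X1 \<ominus> X2) \<otimes> S) \<ominus> ((y2 \<ominus> y1) \<otimes> t \<oplus> (Y2 \<ominus> Y1) \<otimes> T)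
      = (x1 \<otimes> s \<oplus> X1 \<otimes> S \<oplus> (y1 \<otimes> t \<oplus> Y1 \<otimes> T)) \<ominus> (x2 \<otimes> s \<oplus> X2 \<otimes> S \<oplus> (y2 \<otimes> t \<oplus> Y2 \<otimes> T))"
      if "X1 \<in> carrier R" "X2 \<in> carrier R" "S \<in> carrier R" "Y1 \<in> carrier R" "Y2 \<in> carrier R" "T \<in> carrier R"
      for X1 X2 S Y1 Y2 T
      using that xy(1-4) s t by algebra
    have "cnj (x1 \<ominus> x2) = cnj x1 \<ominus> cnj x2" "cnj (y2 \<ominus> y1) = cnj y2 \<ominus> cnj y1"
      using xy by (simp_all add: a_minus_def)
    then show ?thesis
      using *[of "cnj x1" "cnj x2" "cnj s" "cnj y1" "cnj y2" "cnj t"] eq xy(1-4) s t by simp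
  qed
  show ?thesis
  \<comment> \<open>Subtracting in opposite orders moves the \<open>w\<close> part of the collision
    to the other side, which gives the relation without signs.\<close>
  proof (rule that[of "x1 \<ominus> x2" "y2 \<ominus> y1"])
    show "x1 \<ominus> x2 \<noteq> \<zero> \<or> y2 \<ominus> y1 \<noteq> \<zero>" using xy by auto
    show "vadd (smul (x1 \<ominus> x2) v) (smul (cnj (x1 \<ominus> x2)) (cj v)) = vadd (smul (y2 \<ominus> y1) w) (smul (cnj (y2 \<ominus> y1)) (cj w))"
      using xy(6) shift v' w' by (simp add: g_def)
  qed (use xy in auto)
qed

text \<open>Pairing the trace relation with \<open>u\<close> and \<open>u'\<close> gives x B(u, v) =
  y B(u, w) and x B(u', v) = conj(y k) with k a nonsquare. For y nonzero the second equation makes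
  exactly one of x and y a square, so the first can only read 0 = 0; then \<open>cj v\<close> and
  \<open>w\<close> are both orthogonal to \<open>u\<close> and \<open>u'\<close>, hence
  proportional, and the factor is a nonsquare. For y = 0 the situation reduces to incidences of
  equal type.\<close>

lemma join_unique_mixed_type:
  assumes "u \<in> V" "u' \<in> V" "v \<in> V" "w \<in> V" "u \<noteq> zv" "u' \<noteq> zv" "v \<noteq> zv" "w \<noteq> zv"
    and uv: "B (cj u) v = \<zero>" "sq (B u v)" and uw: "B (cj u) w = \<zero>" "sq (B u w)"
    and u'v: "B (cj u') v = \<zero>" "sq (B u' v)" and u'w: "B u' w = \<zero>" "\<not> sq (B (cj u') w)"
  shows "sim v w \<or> sim u u'"
proof -
  define k where "k = B (cj u') w"
  have k: "k \<in> carrier R" "k \<noteq> \<zero>" "\<not> sq k" using assms by (auto simp: k_def)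
  obtain x y where xy: "x \<in> carrier R" "y \<in> carrier R" "x \<noteq> \<zero> \<or> y \<noteq> \<zero>"
    and rel: "vadd (smul x v) (smul (cnj x) (cj v)) = vadd (smul y w) (smul (cnj y) (cj w))"
    using ex_trace_relation[OF assms(3,4)] by blast
  have B_rel: "x \<otimes> B a v \<oplus> cnj x \<otimes> cnj (B (cj a) v) = y \<otimes> B a w \<oplus> cnj y \<otimes> cnj (B (cj a) w)"
    if "a \<in> V" for a
    using arg_cong[OF rel, of "B a"] that assms(3,4) xy(1,2) by (simp add: B_cj_right)
  have Bu: "x \<otimes> B u v = y \<otimes> B u w"
    using B_rel[OF assms(1)] uv(1) uw(1) xy(1,2) assms(1-4) by simp
  have Bu': "x \<otimes> B u' v = cnj y \<otimes> cnj k"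
    using B_rel[OF assms(2)] u'v(1) u'w(1) xy(1,2) assms(1-4) k by (simp add: k_def)
  show ?thesis
  proof (cases "y = \<zero>")
    case True
    then have x: "x \<noteq> \<zero>" using xy by simp
    have "x \<otimes> B u v = \<zero>" "x \<otimes> B u' v = \<zero>"
      using Bu Bu' True assms(1-4) k by simp_all
    then have z: "B u v = \<zero>" "B u' v = \<zero>" using x xy(1) assms(1-4) by (auto simp: integral_iff)
    \<comment> \<open>Since \<open>B u' v\<close> and \<open>B (cj u') v\<close> both vanish, a
      nonsquare multiple of \<open>u'\<close> keeps the incidence with \<open>v\<close> in the first
      alternative, and it brings the one with \<open>w\<close> there too, with the norm of
      \<open>k\<close> as value.\<close>
    define u'' where "u'' = act (cnj k) u'"
    have u''_def': "u'' = smul (cnj k) (cj u')" using k by (simp add: u''_def act_def)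
    have u'': "u'' \<in> V" "u'' \<noteq> zv" "sim u' u''"
      using assms(2,6) k unfolding u''_def sim_def by (auto intro!: bexI[of _ "cnj k"])
    have "sim v w \<or> sim u u''"
    proof (rule join_unique_same_type[OF assms(1) u''(1) assms(3,4,5) u''(2) assms(7,8) uv uw])
      show "B (cj u'') v = \<zero>" "sq (B u'' v)" "B (cj u'') w = \<zero>"
        using assms(2-4) k z u'v u'w by (simp_all add: u''_def')
      have "B u'' w = k \<otimes> cnj k"
        using assms(2-4) k by (simp add: u''_def' m_comm flip: k_def)
      then show "sq (B u'' w)" using sq_norm[OF k(1)] by simp
    qed
    then show ?thesis
      using sim_trans[OF assms(1)] sim_sym[OF assms(2) u''(3)] by blast
  next
    case False
    have nz: "cnj y \<otimes> cnj k \<noteq> \<zero>" using False k xy by simp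
    then have x: "x \<noteq> \<zero>" "B u' v \<noteq> \<zero>"
      using Bu' assms(2,3) xy(1) by (metis B_closed l_null, metis r_null)
    have "sq x \<longleftrightarrow> sq (x \<otimes> B u' v)"
      using sq_mult[of x "B u' v"] x xy(1) assms(2,3) u'v by simp
    also have "\<dots> \<longleftrightarrow> \<not> sq y"
      unfolding Bu' using sq_mult[of "cnj y" "cnj k"] False k xy by simp
    finally have sqxy: "sq x \<longleftrightarrow> \<not> sq y" .
    have z: "B u v = \<zero>"
    proof (rule ccontr)
      assume n: "B u v \<noteq> \<zero>"
      then have "y \<otimes> B u w \<noteq> \<zero>" using Bu x xy(1) assms(1,3) by (metis B_closed mult_nonzero)
      then have n': "B u w \<noteq> \<zero>" using xy(2) by (metis r_null)
      have "sq (x \<otimes> B u v) \<longleftrightarrow> sq x" "sq (y \<otimes> B u w) \<longleftrightarrow> sq y"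
        using sq_mult[of x "B u v"] sq_mult[of y "B u w"] n n' x xy False uv uw assms(1-4) by simp_all
      then show False using Bu sqxy by simp
    qed
    then have "y \<otimes> B u w = \<zero>" using Bu xy by simp
    then have z': "B u w = \<zero>" using False xy assms(1-4) integral[of y "B u w"] by simp
    have "par (cj v) w"
    proof (rule orthogonal_imp_par[of u u'])
      show "\<not> par u u'"
        using z x(2) assms(1,3) by (auto simp: par_def)
    qed (use assms uv u'v z z' in \<open>simp_all add: B_cj_right\<close>)
    then obtain h where h: "h \<in> carrier R" "w = smul h (cj v)" by (auto simp: par_def)
    have "h \<noteq> \<zero>" using h assms by auto
    have "k = h \<otimes> cnj (B u' v)" using assms(2,3) h by (simp add: k_def)
    then have "\<not> sq h"
      using sq_mult[of h "cnj (B u' v)"] h(1) \<open>h \<noteq> \<zero>\<close> x k(3) u'v assms(2,3) by simp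
    then have "sim v w"
      unfolding sim_def using h \<open>h \<noteq> \<zero>\<close> by (intro bexI[of _ h]) (auto simp: act_def)
    then show ?thesis ..
  qed
qed

lemma join_unique:
  assumes "u \<in> V" "u' \<in> V" "v \<in> V" "w \<in> V" "u \<noteq> zv" "u' \<noteq> zv" "v \<noteq> zv" "w \<noteq> zv"
    and "J u v" "J u w" "J u' v" "J u' w"
  shows "sim v w \<or> sim u u'"
proof -
  obtain v' where v': "sim v v'" "B (cj u) v' = \<zero>" "sq (B u v')"
    using J_normalise[OF assms(1,3,9)] .
  obtain w' where w': "sim w w'" "B (cj u) w' = \<zero>" "sq (B u w')"
    using J_normalise[OF assms(1,4,10)] .
  have V: "v' \<in> V" "w' \<in> V" "v' \<noteq> zv" "w' \<noteq> zv"
    using v' w' sim_closed sim_nonzero assms by blast+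
  \<comment> \<open>Now \<open>v'\<close> stays fixed and the line \<open>u'\<close> is rescaled, so
    the two incidences already normalised against \<open>u\<close> are kept.\<close>
  have "J v' u'"
    using J_sim[OF assms(2,3) v'(1)] J_commute[OF assms(2) V(1)] assms(11) by simp
  then obtain t where t: "sim u' t" "B (cj v') t = \<zero>" "sq (B v' t)"
    using J_normalise[OF V(1) assms(2)] by blast
  have tV: "t \<in> V" "t \<noteq> zv" using t sim_closed sim_nonzero assms by blast+
  have tv: "B (cj t) v' = \<zero>" "sq (B t v')"
  proof -
    have "B (cj t) v' = cnj (B (cj v') t)"
      using tV V B_commute[of "cj t" v'] by (simp add: B_cj_right)
    then show "B (cj t) v' = \<zero>" using t by simp
    show "sq (B t v')" using t B_commute[OF tV(1) V(1)] by simp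
  qed
  have "J u' w'" using J_sim[OF assms(2,4) w'(1)] assms(12) by simp
  then have "J t w'"
    using J_sim[OF V(2) assms(2) t(1)] J_commute[OF assms(2) V(2)] J_commute[OF tV(1) V(2)] by simp
  then have "sim v' w' \<or> sim u t"
    unfolding J_def
    using join_unique_same_type[OF assms(1) tV(1) V(1,2) assms(5) tV(2) V(3,4) v'(2,3) w'(2,3) tv]
      join_unique_mixed_type[OF assms(1) tV(1) V(1,2) assms(5) tV(2) V(3,4) v'(2,3) w'(2,3) tv] by blast
  then show ?thesis
  proof
    assume "sim v' w'"
    then have "sim v w'" using sim_trans[OF assms(3) v'(1)] by blast
    then show ?thesis using sim_trans[OF assms(3)] sim_sym[OF assms(4) w'(1)] by blast
  next
    assume "sim u t"
    then show ?thesis using sim_trans[OF assms(1)] sim_sym[OF assms(2) t(1)] by blast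
  qed
qed

section \<open>Counting points through representatives\<close>

definition cls :: "'a \<times> 'a \<times> 'a \<Rightarrow> ('a \<times> 'a \<times> 'a) set" where
  "cls v = {w. sim v w}"

lemma finite_V: "finite V"
  by (simp add: V_def finite_carrier)

lemma card_V: "card V = m ^ 6"
  by (simp add: V_def card_cartesian_product card_carrier flip: power_add)

lemma cls_eq_iff: "v \<in> V \<Longrightarrow> w \<in> V \<Longrightarrow> cls v = cls w \<longleftrightarrow> sim v w"
  unfolding cls_def using sim_refl sim_sym sim_trans by blast

text \<open>The action is free: if a square and a nonsquare multiple agreed, \<open>v\<close> would
  be a nonsquare multiple of \<open>cj v\<close>, which \<open>sq_self_conjugate\<close>
  excludes.\<close>

lemma act_inj:
  assumes v: "v \<in> V" "v \<noteq> zv" and k: "k \<in> carrier R" "k \<noteq> \<zero>" and l: "l \<in> carrier R" "l \<noteq> \<zero>"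
    and eq: "act k v = act l v"
  shows "k = l"
proof -
  have mixed: False
    if k: "k \<in> carrier R" "k \<noteq> \<zero>" and l: "l \<in> carrier R" "l \<noteq> \<zero>" and "sq k" "\<not> sq l"
      and eq: "smul k v = smul l (cj v)" for k l
  proof -
    have "v = smul (inv k) (smul k v)" using v k by simp
    then have "v = smul (inv k \<otimes> l) (cj v)" unfolding eq using v k l by simp
    then have "sq (inv k \<otimes> l)" using sq_self_conjugate[OF v] k l by simp
    then show False using sq_mult[of "inv k" l] k l that by simp
  qed
  show ?thesis
  proof (cases "sq k"; cases "sq l")
    assume "sq k" "sq l"
    then show ?thesis using eq smul_cancel[OF k(1) l(1) v] by (simp add: act_def)
  next
    assume "\<not> sq k" "\<not> sq l"
    then show ?thesis using eq smul_cancel[OF k(1) l(1), of "cj v"] v by (simp add: act_def)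
  qed (use mixed[OF k l] mixed[OF l k] eq in \<open>auto simp: act_def\<close>)
qed

lemma card_cls:
  assumes v: "v \<in> V" "v \<noteq> zv"
  shows "card (cls v) = m\<^sup>2 - 1"
proof -
  have "cls v = (\<lambda>k. act k v) ` (carrier R - {\<zero>})"
    unfolding cls_def sim_def by auto
  moreover have "inj_on (\<lambda>k. act k v) (carrier R - {\<zero>})"
    using act_inj[OF v] by (auto intro!: inj_onI)
  ultimately have "card (cls v) = card (carrier R - {\<zero>})"
    by (simp add: card_image)
  then show ?thesis using finite_carrier by (simp add: card_carrier)
qed

text \<open>Every class of a nonzero vector has m^2 - 1 members, so counts of points reduce to
  counts of vectors in sets closed under \<open>sim\<close>.\<close>

lemma card_classes:
  assumes A: "A \<subseteq> V - {zv}" and closed: "\<And>v w. v \<in> A \<Longrightarrow> sim v w \<Longrightarrow> w \<in> A"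
  shows "card A = (m\<^sup>2 - 1) * card (cls ` A)"
proof -
  have un: "\<Union>(cls ` A) = A"
    using closed sim_refl A by (force simp: cls_def)
  have fin: "finite A" using finite_subset[OF A] finite_V by simp
  have "(m\<^sup>2 - 1) * card (cls ` A) = card (\<Union>(cls ` A))"
  proof (rule card_partition)
    show "finite (cls ` A)" "finite (\<Union>(cls ` A))" using fin un by auto
    show "card c = m\<^sup>2 - 1" if "c \<in> cls ` A" for c
      using that A card_cls by auto
    show "c1 \<inter> c2 = {}" if c: "c1 \<in> cls ` A" "c2 \<in> cls ` A" "c1 \<noteq> c2" for c1 c2
    proof (rule ccontr)
      assume "c1 \<inter> c2 \<noteq> {}"
      then obtain x v w where x: "x \<in> c1" "x \<in> c2" and v: "v \<in> A" "c1 = cls v" and w: "w \<in> A" "c2 = cls w"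
        using c by blast
      then have sim: "sim v x" "sim w x" by (auto simp: cls_def)
      then have "v \<in> V" "w \<in> V" "x \<in> V" using closed[OF v(1)] v w A by blast+
      then have "cls v = cls x" "cls w = cls x" using cls_eq_iff sim by blast+
      then show False using c v w by simp
    qed
  qed
  then show ?thesis using un by simp
qed

lemma vadd_cancel:
  assumes "x \<in> V" "y \<in> V"
  shows "vadd (vadd x y) (smul (\<ominus> \<one>) y) = x" "vadd (vadd x (smul (\<ominus> \<one>) y)) y = x"
proof -
  have "(a \<oplus> b) \<oplus> (\<ominus> \<one>) \<otimes> b = a" "(a \<oplus> (\<ominus> \<one>) \<otimes> b) \<oplus> b = a"
    if "a \<in> carrier R" "b \<in> carrier R" for a b
    using that by algebra+
  then show "vadd (vadd x y) (smul (\<ominus> \<one>) y) = x" "vadd (vadd x (smul (\<ominus> \<one>) y)) y = x"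
    using assms by (elim V_cases; simp)+
qed

text \<open>Each fibre is a translate of the common kernel. Taking \<open>a = b\<close> covers a
  single functional.\<close>

lemma card_fibre:
  assumes "a \<in> V" "b \<in> V" "v \<in> V"
  shows "card {x \<in> V. B a x = B a v \<and> B b x = B b v} = card {x \<in> V. B a x = \<zero> \<and> B b x = \<zero>}"
proof (rule bij_betw_same_card[symmetric])
  show "bij_betw (\<lambda>x. vadd x v) {x \<in> V. B a x = \<zero> \<and> B b x = \<zero>} {x \<in> V. B a x = B a v \<and> B b x = B b v}"
    by (rule bij_betw_byWitness[where f' = "\<lambda>x. vadd x (smul (\<ominus> \<one>) v)"])
      (use assms in \<open>auto simp: vadd_cancel l_minus r_neg\<close>)
qed

lemma card_orthogonal:
  assumes u: "u \<in> V" "u \<noteq> zv"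
  shows "card {v \<in> V. B u v = \<zero>} = m ^ 4"
proof -
  obtain w where w: "w \<in> V" "B u w \<noteq> \<zero>" using B_nondegenerate[OF u] by blast
  have "\<exists>v\<in>V. B u v = y" if "y \<in> carrier R" for y
    using that w u by (intro bexI[of _ "smul (y \<otimes> inv (B u w)) w"]) (simp_all add: m_assoc)
  then have im: "B u ` V = carrier R" using u by auto
  have "card {x \<in> V. B u x = y} = card {v \<in> V. B u v = \<zero>}" if y: "y \<in> carrier R" for y
  proof -
    obtain v where "v \<in> V" "y = B u v" using im y by blast
    then show ?thesis using card_fibre[of u u v] u by simp
  qed
  then have "(\<Sum>y\<in>carrier R. card {x \<in> V. B u x = y}) = (\<Sum>y\<in>carrier R. card {v \<in> V. B u v = \<zero>})"
    by (rule sum.cong[OF refl])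
  then have "m ^ 6 = m\<^sup>2 * card {v \<in> V. B u v = \<zero>}"
    using card_eq_sum_fibres[OF finite_V, of "B u"] by (simp add: im card_V card_carrier)
  then have "m\<^sup>2 * card {v \<in> V. B u v = \<zero>} = m\<^sup>2 * m ^ 4" by (simp flip: power_add)
  then show ?thesis
    using m_ge_2 mult_left_cancel[of "m\<^sup>2"] by (simp del: power_add_numeral)
qed

lemma card_kernel:
  assumes "a \<in> V" "b \<in> V" "a \<noteq> zv" "\<not> par a b"
  shows "card {v \<in> V. B a v = \<zero> \<and> B b v = \<zero>} = m\<^sup>2"
proof -
  let ?c = "cross a b"
  have c: "?c \<in> V" "?c \<noteq> zv" using assms cross_eq_zv_imp_par cross_closed by blast+
  have "{v \<in> V. B a v = \<zero> \<and> B b v = \<zero>} = (\<lambda>k. smul k ?c) ` carrier R"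
  proof (intro equalityI subsetI)
    fix v assume "v \<in> {v \<in> V. B a v = \<zero> \<and> B b v = \<zero>}"
    then have "par ?c v" using orthogonal_imp_par_cross[of a b v] assms c by simp
    then show "v \<in> (\<lambda>k. smul k ?c) ` carrier R" by (auto simp: par_def)
  next
    fix v assume "v \<in> (\<lambda>k. smul k ?c) ` carrier R"
    then show "v \<in> {v \<in> V. B a v = \<zero> \<and> B b v = \<zero>}" using assms c B_cross[of a b] by auto
  qed
  moreover have "inj_on (\<lambda>k. smul k ?c) (carrier R)"
    using smul_cancel[OF _ _ c] by (rule inj_onI)
  ultimately show ?thesis by (simp add: card_image card_carrier)
qed

text \<open>If \<open>cj u\<close> is a multiple of \<open>u\<close>, both values in
  \<open>J\<close> vanish together and the line is the orthogonal plane of \<open>u\<close>.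
  Otherwise \<open>B u\<close> and \<open>B (cj u)\<close> together map V onto K^2 with fibres of
  size m^2, and \<open>J\<close> selects m^2 values: each element of K occurs once, squares in the
  first coordinate and nonsquares in the second.\<close>

lemma card_line:
  assumes u: "u \<in> V" "u \<noteq> zv"
  shows "card {v \<in> V. J u v} = m ^ 4"
proof (cases "par u (cj u)")
  case True
  then obtain d where d: "d \<in> carrier R" "cj u = smul d u" by (auto simp: par_def)
  have "d \<noteq> \<zero>" using d u cj_eq_zv[of u] by auto
  then have "J u v \<longleftrightarrow> B u v = \<zero>" if "v \<in> V" for v
    unfolding J_def d(2) using that u d(1) by (auto simp: integral_iff)
  then have "{v \<in> V. J u v} = {v \<in> V. B u v = \<zero>}" by auto
  then show ?thesis using card_orthogonal[OF u] by simp
next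
  case False
  define f where "f v = (B u v, B (cj u) v)" for v
  have fibre: "card {x \<in> V. f x = t} = m\<^sup>2" if "t \<in> f ` V" for t
    using that card_fibre[of u "cj u"] card_kernel[of u "cj u"] u False by (auto simp: f_def)
  \<comment> \<open>Surjectivity comes from counting: V is covered by fibres of size m^2, so the
    image has m^4 elements.\<close>
  have "m ^ 6 = card (f ` V) * m\<^sup>2"
    using card_eq_sum_fibres[OF finite_V, of f] fibre by (simp add: card_V)
  then have "m\<^sup>2 * card (f ` V) = m\<^sup>2 * m ^ 4" by (simp add: mult.commute flip: power_add)
  then have "card (f ` V) = m ^ 4"
    using m_ge_2 mult_left_cancel[of "m\<^sup>2"] by (simp del: power_add_numeral)
  moreover have "card (carrier R \<times> carrier R) = m ^ 4"
    by (simp add: card_cartesian_product card_carrier flip: power_add)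
  moreover have "f ` V \<subseteq> carrier R \<times> carrier R" using u by (auto simp: f_def)
  ultimately have im: "f ` V = carrier R \<times> carrier R"
    by (intro card_subset_eq) (simp_all add: finite_carrier)
  let ?S = "{x \<in> carrier R. sq x}"
  let ?N = "{x \<in> carrier R. \<not> sq x}"
  define T where "T = (\<lambda>x. (x, \<zero>)) ` ?S \<union> (\<lambda>y. (\<zero>, y)) ` ?N"
  have JT: "J u v \<longleftrightarrow> f v \<in> T" if "v \<in> V" for v
    using that u by (auto simp: J_def f_def T_def)
  have "card T = card ?S + card ?N"
    unfolding T_def using finite_carrier
    by (subst card_Un_disjoint) (auto simp: card_image inj_on_def)
  also have "\<dots> = card (?S \<union> ?N)"
    using finite_carrier by (subst card_Un_disjoint) auto
  also have "?S \<union> ?N = carrier R" by auto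
  finally have T: "card T = m\<^sup>2" by (simp add: card_carrier)
  have "T \<subseteq> f ` V" unfolding im by (auto simp: T_def)
  have "f ` {v \<in> V. J u v} = T"
    using \<open>T \<subseteq> f ` V\<close> JT by force
  moreover have "card {x \<in> {v \<in> V. J u v}. f x = t} = m\<^sup>2" if "t \<in> T" for t
  proof -
    have "{x \<in> {v \<in> V. J u v}. f x = t} = {x \<in> V. f x = t}" using JT that by auto
    then show ?thesis using fibre[of t] \<open>T \<subseteq> f ` V\<close> that by auto
  qed
  ultimately have "card {v \<in> V. J u v} = card T * m\<^sup>2"
    using card_eq_sum_fibres[of "{v \<in> V. J u v}" f] finite_V by simp
  then show ?thesis using T by (simp flip: power_add)
qed

section \<open>Counting absolute vectors\<close>

lemma cnj_imaginary_ratio: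
  assumes "x \<in> carrier R" "y \<in> carrier R" "y \<noteq> \<zero>" "cnj x = \<ominus> x" "cnj y = \<ominus> y"
  shows "cnj (x \<otimes> inv y) = x \<otimes> inv y"
  using assms by (simp add: inv_minus l_minus r_minus)

text \<open>For a fixed nonzero imaginary \<open>l\<close>, the pair (i, w) with i nonzero
  corresponds to t = (l / i) w. The factor l / i lies in F, so it is a square and can be pulled out
  of traces: t + conj(t) = l i recovers i, and t is a square exactly when w is. For i = 0 the trace
  of w is zero and t = w.\<close>

lemma card_square_imaginary_pairs:
  "card {(i, w). i \<in> carrier R \<and> w \<in> carrier R \<and> cnj i = \<ominus> i \<and> w \<oplus> cnj w = i \<otimes> i \<and> sq w}
    = card {x \<in> carrier R. sq x}" (is "card ?E = card ?S")
proof -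
  obtain l where l: "l \<in> carrier R" "l \<noteq> \<zero>" "cnj l = \<ominus> l" using ex_imaginary by blast
  have ratio: "cnj (x \<otimes> inv y) = x \<otimes> inv y" "sq ((x \<otimes> inv y) \<otimes> w) \<longleftrightarrow> sq w"
    if x: "x \<in> carrier R" "x \<noteq> \<zero>" "cnj x = \<ominus> x" and y: "y \<in> carrier R" "y \<noteq> \<zero>" "cnj y = \<ominus> y"
      and w: "w \<in> carrier R" for x y w
  proof -
    show *: "cnj (x \<otimes> inv y) = x \<otimes> inv y" by (rule cnj_imaginary_ratio) (fact x y)+
    show "sq ((x \<otimes> inv y) \<otimes> w) \<longleftrightarrow> sq w"
      using sq_mult[of "x \<otimes> inv y" w] sq_real[OF _ *] x(1,2) y(1,2) w
      by (cases "w = \<zero>") auto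
  qed
  define f where "f = (\<lambda>(i, w). if i = \<zero> then w else (l \<otimes> inv i) \<otimes> w)"
  define im where "im t = (t \<oplus> cnj t) \<otimes> inv l" for t
  define g where "g t = (im t, if im t = \<zero> then t else (im t \<otimes> inv l) \<otimes> t)" for t
  have f: "f (i, w) \<in> ?S \<and> g (f (i, w)) = (i, w)"
    if i: "i \<in> carrier R" "cnj i = \<ominus> i" and w: "w \<in> carrier R" "sq w" and eq: "w \<oplus> cnj w = i \<otimes> i" for i w
  proof (cases "i = \<zero>")
    case True
    then show ?thesis using i w l eq by (simp add: f_def g_def im_def)
  next
    case False
    define t where "t = (l \<otimes> inv i) \<otimes> w"
    have t: "t \<in> carrier R" "f (i, w) = t" "sq t"
      using ratio[OF l i(1) False i(2) w(1)] i l w False by (simp_all add: t_def f_def)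
    have "t \<oplus> cnj t = (l \<otimes> inv i) \<otimes> (w \<oplus> cnj w)"
      unfolding t_def using ratio(1)[OF l i(1) False i(2) w(1)] i(1) l(1) w False
      by (simp add: r_distr del: cnj_inv)
    also have "\<dots> = l \<otimes> i \<otimes> (inv i \<otimes> i)"
      unfolding eq using i(1) l(1) inv_closed'[OF i(1) False] by algebra
    finally have "t \<oplus> cnj t = i \<otimes> l" using i l False by (simp add: m_comm)
    then have im: "im t = i" using i l by (simp add: im_def m_assoc)
    have "(i \<otimes> inv l) \<otimes> t = (i \<otimes> inv i) \<otimes> (l \<otimes> inv l) \<otimes> w"
      unfolding t_def using i(1) l(1) inv_closed'[OF i(1) False] inv_closed'[OF l(1,2)] w(1) by algebra
    then have "(i \<otimes> inv l) \<otimes> t = w" using i(1) l(1,2) w False by simp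
    then show ?thesis using t im False by (simp add: g_def)
  qed
  have g: "g t \<in> ?E \<and> f (g t) = t" if t: "t \<in> carrier R" "sq t" for t
  proof -
    have imt: "im t \<in> carrier R" "cnj (im t) = \<ominus> im t" "im t \<otimes> l = t \<oplus> cnj t"
      using t l by (simp_all add: im_def inv_minus r_minus m_assoc a_comm)
    show ?thesis
    proof (cases "im t = \<zero>")
      case True
      then have "t \<oplus> cnj t = \<zero>" using imt l by simp
      then show ?thesis using True t by (simp add: g_def f_def)
    next
      case False
      define w where "w = (im t \<otimes> inv l) \<otimes> t"
      have w: "w \<in> carrier R" "sq w"
        using ratio[OF imt(1) False imt(2) l t(1)] imt l t by (simp_all add: w_def)
      have "w \<oplus> cnj w = (im t \<otimes> inv l) \<otimes> (t \<oplus> cnj t)"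
        unfolding w_def using ratio(1)[OF imt(1) False imt(2) l t(1)] imt(1) l(1,2) t
        by (simp add: r_distr del: cnj_inv)
      also have "\<dots> = im t \<otimes> im t \<otimes> (l \<otimes> inv l)"
        unfolding imt(3)[symmetric] using imt(1) l(1) inv_closed'[OF l(1,2)] by algebra
      finally have "w \<oplus> cnj w = im t \<otimes> im t" using imt l by simp
      moreover have "(l \<otimes> inv (im t)) \<otimes> w = (im t \<otimes> inv (im t)) \<otimes> (l \<otimes> inv l) \<otimes> t"
        unfolding w_def using imt(1) l(1) inv_closed'[OF imt(1) False] inv_closed'[OF l(1,2)] t(1) by algebra
      then have "(l \<otimes> inv (im t)) \<otimes> w = t" using imt(1) l(1,2) t False by simp
      ultimately show ?thesis using w imt False by (simp add: g_def f_def flip: w_def)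
    qed
  qed
  have "bij_betw f ?E ?S"
  proof (rule bij_betw_byWitness[where f' = g])
    show "\<forall>a\<in>?E. g (f a) = a" "f ` ?E \<subseteq> ?S" using f by blast+
    show "\<forall>t\<in>?S. f (g t) = t" using g by (intro ballI) simp
    show "g ` ?S \<subseteq> ?E" by (intro image_subsetI conjunct1[OF g]) simp_all
  qed
  then show ?thesis by (rule bij_betw_same_card)
qed

text \<open>Only \<open>y \<ominus> cnj y\<close> enters the condition. Splitting y into y +
  conj(y), an arbitrary element of F, and y - conj(y) leaves the imaginary count with a factor
  m.\<close>

lemma card_square_pairs:
  "card {(y, w). y \<in> carrier R \<and> w \<in> carrier R \<and> w \<oplus> cnj w = (y \<ominus> cnj y) \<otimes> (y \<ominus> cnj y) \<and> sq w}
    = m * card {x \<in> carrier R. sq x}" (is "card ?D = _")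
proof -
  let ?F = "{x \<in> carrier R. cnj x = x}"
  let ?E = "{(i, w). i \<in> carrier R \<and> w \<in> carrier R \<and> cnj i = \<ominus> i \<and> w \<oplus> cnj w = i \<otimes> i \<and> sq w}"
  have 1: "half \<otimes> ((y \<oplus> z) \<oplus> (y \<ominus> z)) = (half \<oplus> half) \<otimes> y"
    "half \<otimes> (y \<oplus> z) \<oplus> half \<otimes> (y \<ominus> z) = (half \<oplus> half) \<otimes> y"
    "half \<otimes> (y \<oplus> z) \<ominus> half \<otimes> (y \<ominus> z) = (half \<oplus> half) \<otimes> z"
    "z \<ominus> y = \<ominus> (y \<ominus> z)"
    if "y \<in> carrier R" "z \<in> carrier R" for y z
    using that half_closed by algebra+
  have "bij_betw (\<lambda>(y, w). (y \<oplus> cnj y, (y \<ominus> cnj y, w))) ?D (?F \<times> ?E)"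
  proof (rule bij_betw_byWitness[where f' = "\<lambda>(r, (i, w)). (half \<otimes> (r \<oplus> i), w)"])
    have c: "cnj (half \<otimes> (r \<oplus> i)) = half \<otimes> (r \<ominus> i)"
      if "r \<in> carrier R" "i \<in> carrier R" "cnj r = r" "cnj i = \<ominus> i" for r i
      using that by (simp add: a_minus_def)
    show "\<forall>a\<in>?D. (\<lambda>(r, i, w). (half \<otimes> (r \<oplus> i), w)) ((\<lambda>(y, w). (y \<oplus> cnj y, y \<ominus> cnj y, w)) a) = a"
      by (auto simp: 1(1) half_add_half)
    show "\<forall>a\<in>?F \<times> ?E. (\<lambda>(y, w). (y \<oplus> cnj y, y \<ominus> cnj y, w)) ((\<lambda>(r, i, w). (half \<otimes> (r \<oplus> i), w)) a) = a"
      by (auto simp: c 1(2,3) half_add_half simp del: cnj_mult)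
    show "(\<lambda>(y, w). (y \<oplus> cnj y, y \<ominus> cnj y, w)) ` ?D \<subseteq> ?F \<times> ?E"
    proof -
      have "cnj y \<oplus> y = y \<oplus> cnj y" "cnj y \<ominus> y = \<ominus> (y \<ominus> cnj y)" if "y \<in> carrier R" for y
        using that 1(4)[of y "cnj y"] by (simp_all add: a_comm)
      then show ?thesis by auto
    qed
    show "(\<lambda>(r, i, w). (half \<otimes> (r \<oplus> i), w)) ` (?F \<times> ?E) \<subseteq> ?D"
      by (auto simp: c 1(3) half_add_half simp del: cnj_mult)
  qed
  then have "card ?D = card (?F \<times> ?E)" by (rule bij_betw_same_card)
  then show ?thesis
    by (simp add: card_cartesian_product card_real card_square_imaginary_pairs)
qed

text \<open>The conditions say that (1, y, z) is absolute. The substitution w = 2 z + y^2, inverted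
  by halving, turns z + y conj(y) + conj(z) = 0 into w + conj(w) = (y - conj(y))^2.\<close>

lemma card_absolute_affine:
  "card {(y, z). y \<in> carrier R \<and> z \<in> carrier R \<and> z \<oplus> y \<otimes> cnj y \<oplus> cnj z = \<zero> \<and> sq (z \<oplus> y \<otimes> y \<oplus> z)}
    = m * card {x \<in> carrier R. sq x}" (is "card ?C = _")
proof -
  let ?D = "{(y, w). y \<in> carrier R \<and> w \<in> carrier R \<and> w \<oplus> cnj w = (y \<ominus> cnj y) \<otimes> (y \<ominus> cnj y) \<and> sq w}"
  have 1: "(z \<oplus> y \<otimes> y \<oplus> z) \<oplus> (Z \<oplus> Y \<otimes> Y \<oplus> Z) = (y \<ominus> Y) \<otimes> (y \<ominus> Y) \<oplus> ((z \<oplus> y \<otimes> Y \<oplus> Z) \<oplus> (z \<oplus> y \<otimes> Y \<oplus> Z))"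
    "half \<otimes> (z \<ominus> y \<otimes> y) \<oplus> (half \<oplus> half) \<otimes> (y \<otimes> Y) \<oplus> half \<otimes> (Z \<ominus> Y \<otimes> Y) = half \<otimes> ((z \<oplus> Z) \<ominus> (y \<ominus> Y) \<otimes> (y \<ominus> Y))"
    "half \<otimes> ((z \<oplus> y \<otimes> y \<oplus> z) \<ominus> y \<otimes> y) = (half \<oplus> half) \<otimes> z"
    "half \<otimes> (z \<ominus> y \<otimes> y) \<oplus> y \<otimes> y \<oplus> half \<otimes> (z \<ominus> y \<otimes> y) = (half \<oplus> half) \<otimes> (z \<ominus> y \<otimes> y) \<oplus> y \<otimes> y"
    "(z \<ominus> y \<otimes> y) \<oplus> y \<otimes> y = z"
    if "y \<in> carrier R" "z \<in> carrier R" "Y \<in> carrier R" "Z \<in> carrier R" for y z Y Z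
    using that half_closed by algebra+
  have "bij_betw (\<lambda>(y, z). (y, z \<oplus> y \<otimes> y \<oplus> z)) ?C ?D"
  proof (rule bij_betw_byWitness[where f' = "\<lambda>(y, w). (y, half \<otimes> (w \<ominus> y \<otimes> y))"])
    show "\<forall>a\<in>?C. (\<lambda>(y, w). (y, half \<otimes> (w \<ominus> y \<otimes> y))) ((\<lambda>(y, z). (y, z \<oplus> y \<otimes> y \<oplus> z)) a) = a"
      by (auto simp: 1(3) half_add_half)
    show "\<forall>a\<in>?D. (\<lambda>(y, z). (y, z \<oplus> y \<otimes> y \<oplus> z)) ((\<lambda>(y, w). (y, half \<otimes> (w \<ominus> y \<otimes> y))) a) = a"
      by (auto simp: 1(4,5) half_add_half)
    show "(\<lambda>(y, z). (y, z \<oplus> y \<otimes> y \<oplus> z)) ` ?C \<subseteq> ?D"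
      by (auto simp: 1(1))
    have "half \<otimes> (w \<ominus> y \<otimes> y) \<oplus> y \<otimes> cnj y \<oplus> half \<otimes> (cnj w \<ominus> cnj y \<otimes> cnj y) = \<zero>"
      if "y \<in> carrier R" "w \<in> carrier R" "w \<oplus> cnj w = (y \<ominus> cnj y) \<otimes> (y \<ominus> cnj y)" for y w
      using 1(2)[of y w "cnj y" "cnj w"] that by (simp add: half_add_half)
    then show "(\<lambda>(y, w). (y, half \<otimes> (w \<ominus> y \<otimes> y))) ` ?D \<subseteq> ?C"
      by (auto simp: 1(4,5) half_add_half)
  qed
  then have "card ?C = card ?D" by (rule bij_betw_same_card)
  then show ?thesis by (simp add: card_square_pairs)
qed

text \<open>\<open>B (cj v) v\<close> is fixed by conjugation, hence a square, so the second
  alternative never occurs on the diagonal.\<close>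

lemma J_self: "v \<in> V \<Longrightarrow> J v v \<longleftrightarrow> B (cj v) v = \<zero> \<and> sq (B v v)"
proof -
  assume v: "v \<in> V"
  have "cnj (B (cj v) v) = B (cj v) v"
    using v B_commute[of v "cj v"] by (simp add: B_cj_right)
  then have "sq (B (cj v) v)" using v by (simp add: sq_real)
  then show "J v v \<longleftrightarrow> B (cj v) v = \<zero> \<and> sq (B v v)" by (simp add: J_def)
qed

text \<open>If the first coordinate is zero, the Hermitian condition becomes y conj(y) = 0 and
  leaves only the vectors (0, 0, z). All others are x (1, y, z) with x nonzero; this scaling
  multiplies \<open>B (cj v) v\<close> by the norm of x and \<open>B v v\<close> by x^2, so it
  preserves both conditions even for nonsquare x.\<close>

lemma card_absolute_vectors:
  "card {v \<in> V. v \<noteq> zv \<and> J v v} = (m\<^sup>2 - 1) * (1 + m * card {x \<in> carrier R. sq x})"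
proof -
  let ?U = "carrier R - {\<zero>}"
  let ?C = "{(y, z). y \<in> carrier R \<and> z \<in> carrier R \<and> z \<oplus> y \<otimes> cnj y \<oplus> cnj z = \<zero> \<and> sq (z \<oplus> y \<otimes> y \<oplus> z)}"
  define f where "f = (\<lambda>(x, y, z). (x, x \<otimes> y, x \<otimes> z))"
  define g where "g = (\<lambda>z::'a. (\<zero>, \<zero>, z))"
  have scaled: "J (x, x \<otimes> y, x \<otimes> z) (x, x \<otimes> y, x \<otimes> z) \<longleftrightarrow> (y, z) \<in> ?C"
    if x: "x \<in> carrier R" "x \<noteq> \<zero>" and y: "y \<in> carrier R" and z: "z \<in> carrier R" for x y z
  proof -
    have 1: "x' \<otimes> (x \<otimes> z) \<oplus> (x' \<otimes> y') \<otimes> (x \<otimes> y) \<oplus> (x' \<otimes> z') \<otimes> x = (x \<otimes> x') \<otimes> (z \<oplus> y \<otimes> y' \<oplus> z')"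
      "x \<otimes> (x \<otimes> z) \<oplus> (x \<otimes> y) \<otimes> (x \<otimes> y) \<oplus> (x \<otimes> z) \<otimes> x = (x \<otimes> x) \<otimes> (z \<oplus> y \<otimes> y \<oplus> z)"
      if "x' \<in> carrier R" "y' \<in> carrier R" "z' \<in> carrier R" for x' y' z'
      using that x(1) y z by algebra+
    have "sq (x \<otimes> x)" using sq_mult[of x x] x by simp
    then have "sq ((x \<otimes> x) \<otimes> s) \<longleftrightarrow> sq s" if "s \<in> carrier R" for s
      using sq_mult_nonzero_left[of "x \<otimes> x" s] x that by auto
    then show ?thesis
      using x y z 1[of "cnj x" "cnj y" "cnj z"] by (simp add: J_self integral_iff)
  qed
  have "{v \<in> V. v \<noteq> zv \<and> J v v} = g ` ?U \<union> f ` (?U \<times> ?C)"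
  proof (intro equalityI subsetI)
    fix v assume "v \<in> {v \<in> V. v \<noteq> zv \<and> J v v}"
    then have "v \<in> V" and v0: "v \<noteq> zv" and J: "J v v" by auto
    then obtain x y z where v: "v = (x, y, z)" "x \<in> carrier R" "y \<in> carrier R" "z \<in> carrier R"
      using V_cases by blast
    show "v \<in> g ` ?U \<union> f ` (?U \<times> ?C)"
    proof (cases "x = \<zero>")
      case True
      then have "y = \<zero>" using J J_self[OF \<open>v \<in> V\<close>] v by (simp add: integral_iff)
      then have "v = g z" "z \<in> ?U" using True v v0 by (auto simp: g_def zv_def)
      then show ?thesis by blast
    next
      case False
      have yz: "y = x \<otimes> (inv x \<otimes> y)" "z = x \<otimes> (inv x \<otimes> z)"
        using v False by (simp_all flip: m_assoc)
      have "(inv x \<otimes> y, inv x \<otimes> z) \<in> ?C"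
        using scaled[of x "inv x \<otimes> y" "inv x \<otimes> z"] v(2-4) False J unfolding v(1) yz[symmetric] by simp
      moreover have "v = f (x, inv x \<otimes> y, inv x \<otimes> z)" using v(1) yz by (simp add: f_def)
      ultimately show ?thesis using v(2) False by blast
    qed
  next
    fix v assume "v \<in> g ` ?U \<union> f ` (?U \<times> ?C)"
    then show "v \<in> {v \<in> V. v \<noteq> zv \<and> J v v}"
    proof
      assume "v \<in> g ` ?U"
      then show ?thesis by (auto simp: g_def zv_def J_self)
    next
      assume "v \<in> f ` (?U \<times> ?C)"
      then obtain x y z where v: "v = (x, x \<otimes> y, x \<otimes> z)" "x \<in> carrier R" "x \<noteq> \<zero>" "(y, z) \<in> ?C"
        unfolding f_def by (elim imageE SigmaE) auto
      then have "J v v" using scaled[of x y z] by auto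
      then show ?thesis using v by (auto simp: zv_def)
    qed
  qed
  moreover have "g ` ?U \<inter> f ` (?U \<times> ?C) = {}" by (auto simp: f_def g_def)
  moreover have "finite ?C"
    by (rule finite_subset[of _ "carrier R \<times> carrier R"]) (auto simp: finite_carrier)
  ultimately have "card {v \<in> V. v \<noteq> zv \<and> J v v} = card (g ` ?U) + card (f ` (?U \<times> ?C))"
    using finite_carrier by (simp add: card_Un_disjoint)
  moreover have "card (g ` ?U) = card ?U" by (rule card_image) (auto simp: g_def inj_on_def)
  moreover have "card (f ` (?U \<times> ?C)) = card (?U \<times> ?C)"
    by (rule card_image) (auto simp: f_def inj_on_def m_lcancel)
  moreover have "card ?U = m\<^sup>2 - 1" using finite_carrier by (simp add: card_carrier)
  ultimately show ?thesis
    by (simp add: card_cartesian_product card_absolute_affine algebra_simps)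
qed

section \<open>The plane of classes\<close>

definition points :: "('a \<times> 'a \<times> 'a) set set" where
  "points = cls ` (V - {zv})"

definition incident :: "('a \<times> 'a \<times> 'a) set \<Rightarrow> ('a \<times> 'a \<times> 'a) set \<Rightarrow> bool" where
  "incident M N \<longleftrightarrow> (\<exists>u\<in>M. \<exists>v\<in>N. J u v)"

lemma incident_cls:
  assumes "u \<in> V" "v \<in> V"
  shows "incident (cls u) (cls v) \<longleftrightarrow> J u v"
proof
  assume "incident (cls u) (cls v)"
  then obtain u' v' where *: "sim u u'" "sim v v'" "J u' v'"
    by (auto simp: incident_def cls_def)
  have V: "u' \<in> V" "v' \<in> V" using sim_closed * assms by blast+
  have "J u' v" using J_sim[OF V(1) assms(2) *(2)] *(3) by simp
  then have "J v u'" using J_commute[OF V(1) assms(2)] by simp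
  then have "J v u" using J_sim[OF assms(2,1) *(1)] by simp
  then show "J u v" using J_commute[OF assms] by simp
next
  assume "J u v"
  then show "incident (cls u) (cls v)"
    unfolding incident_def cls_def using sim_refl assms by blast
qed

lemma card_points: "card points = (m\<^sup>2)\<^sup>2 + m\<^sup>2 + 1"
proof -
  \<comment> \<open>Subtraction is truncated on naturals; writing m^2 as a successor turns the
    factor m^2 - 1 into a positive \<open>k\<close> that can be cancelled.\<close>
  obtain k where k: "m\<^sup>2 = Suc k" "k > 0"
    using m_ge_2 power_mono[of 2 m 2] by (cases "m\<^sup>2") auto
  have "card (V - {zv}) = (m\<^sup>2 - 1) * card points"
    unfolding points_def
  proof (rule card_classes)
    show "w \<in> V - {zv}" if "v \<in> V - {zv}" "sim v w" for v w
      using that sim_closed[of v w] sim_nonzero[of v w] by blast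
  qed simp
  also have "card (V - {zv}) = (m\<^sup>2) ^ 3 - 1"
    using finite_V by (simp add: card_V)
  also have "\<dots> = (m\<^sup>2 - 1) * ((m\<^sup>2)\<^sup>2 + m\<^sup>2 + 1)"
    unfolding k by (simp add: power2_eq_square power3_eq_cube algebra_simps)
  finally show ?thesis using k by (simp only: nat_mult_eq_cancel1 diff_Suc_1)
qed

lemma card_incident:
  assumes "M \<in> points"
  shows "card {N \<in> points. incident M N} = m\<^sup>2 + 1"
proof -
  obtain k where k: "m\<^sup>2 = Suc k" "k > 0"
    using m_ge_2 power_mono[of 2 m 2] by (cases "m\<^sup>2") auto
  obtain u where u: "u \<in> V" "u \<noteq> zv" "M = cls u" using assms by (auto simp: points_def)
  let ?A = "{v \<in> V. J u v} - {zv}"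
  have "{N \<in> points. incident M N} = cls ` ?A"
    unfolding points_def u(3) using incident_cls[OF u(1)] by blast
  moreover have "card ?A = (m\<^sup>2 - 1) * card (cls ` ?A)"
  proof (rule card_classes)
    show "w \<in> ?A" if "v \<in> ?A" "sim v w" for v w
      using that J_sim[OF u(1), of v w] sim_closed[of v w] sim_nonzero[of v w] by blast
  qed auto
  \<comment> \<open>\<open>J u zv\<close> holds, so removing the zero vector lowers the count by
    one.\<close>
  moreover have "card ?A = m ^ 4 - 1"
    using finite_V card_line[OF u(1,2)] u by (subst card_Diff_singleton) (auto simp: J_def)
  moreover have "m ^ 4 = (m\<^sup>2)\<^sup>2" by simp
  moreover have "(m\<^sup>2)\<^sup>2 - 1 = (m\<^sup>2 - 1) * (m\<^sup>2 + 1)"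
    unfolding k by (simp add: power2_eq_square algebra_simps)
  ultimately show ?thesis using k by (simp only: nat_mult_eq_cancel1 diff_Suc_1)
qed

lemma card_absolute: "card {M \<in> points. incident M M} = 1 + m * card {x \<in> carrier R. sq x}"
proof -
  obtain k where k: "m\<^sup>2 = Suc k" "k > 0"
    using m_ge_2 power_mono[of 2 m 2] by (cases "m\<^sup>2") auto
  let ?A = "{v \<in> V. v \<noteq> zv \<and> J v v}"
  have "{M \<in> points. incident M M} = cls ` ?A"
    unfolding points_def using incident_cls by blast
  moreover have "card ?A = (m\<^sup>2 - 1) * card (cls ` ?A)"
  proof (rule card_classes)
    fix v w assume v: "v \<in> ?A" and sim: "sim v w"
    then have w: "w \<in> V" "w \<noteq> zv" using sim_closed sim_nonzero by blast+
    have "J w v" using J_sim[of v v w] J_commute[of v w] v sim w by blast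
    then show "w \<in> ?A" using J_sim[of w v w] v sim w by blast
  qed auto
  ultimately show ?thesis
    using card_absolute_vectors k by (simp only: nat_mult_eq_cancel1 diff_Suc_1)
qed

lemma hughes_plane_polarity:
  "\<exists>(P :: nat set) I. projective_plane_of_order P P I (m\<^sup>2) \<and>
    is_polarity P P I (\<lambda>x. x) (\<lambda>x. x) \<and>
    card (absolute_points P I (\<lambda>x. x)) = 1 + m * card {x \<in> carrier R. sq x} \<and>
    1 + m * card {x \<in> carrier R. sq x} \<le> independence_number P (polarity_adj I (\<lambda>x. x))"
proof -
  have rep: "\<exists>v\<in>V. v \<noteq> zv \<and> M = cls v" if "M \<in> points" for M
    using that by (auto simp: points_def)
  have sym: "incident M N \<longleftrightarrow> incident N M" if MN: "M \<in> points" "N \<in> points" for M N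
  proof -
    obtain u v where "u \<in> V" "v \<in> V" "M = cls u" "N = cls v" using rep MN by meson
    then show ?thesis using incident_cls J_commute by simp
  qed
  have uniq: "U = W"
    if "M \<in> points" "N \<in> points" "U \<in> points" "W \<in> points"
      and inc: "incident M U" "incident N U" "incident M W" "incident N W" and "M \<noteq> N" for M N U W
  proof -
    obtain x where x: "x \<in> V" "x \<noteq> zv" "M = cls x" using rep \<open>M \<in> points\<close> by blast
    obtain y where y: "y \<in> V" "y \<noteq> zv" "N = cls y" using rep \<open>N \<in> points\<close> by blast
    obtain u where u: "u \<in> V" "u \<noteq> zv" "U = cls u" using rep \<open>U \<in> points\<close> by blast
    obtain w where w: "w \<in> V" "w \<noteq> zv" "W = cls w" using rep \<open>W \<in> points\<close> by blast
    have "J x u" "J y u" "J x w" "J y w"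
      using inc incident_cls x y u w by simp_all
    then have "sim u w \<or> sim x y"
      by (intro join_unique[OF x(1) y(1) u(1) w(1) x(2) y(2) u(2) w(2)])
    then show ?thesis
      using \<open>M \<noteq> N\<close> cls_eq_iff x y u w by metis
  qed
  have "m\<^sup>2 \<ge> 2" using m_ge_2 power_mono[of 2 m 2] by simp
  moreover have "finite points" using finite_V by (simp add: points_def)
  ultimately show ?thesis
    using symmetric_incidence_polarity[OF _ card_points _ sym card_incident uniq]
    by (simp add: card_absolute)
qed

end

text \<open>With m = 2 a + 1, the exponent e = (m - 1)(m + 1) / 2 = 2 a (a + 1) detects squares by
  Euler's criterion. It is a multiple of m - 1, so nonzero elements of F pass the test; a ratio c =
  x^(m - 1) passes because c^e = (x^(2 e))^a = 1.\<close>

lemma (in field) finite_field_conjugation: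
  assumes fin: "finite (carrier R)" and card: "card (carrier R) = m\<^sup>2"
    and p: "prime p" and char: "[p] \<cdot> \<one> = \<zero>" and m: "m = p ^ n" and odd: "odd m" and "m > 1"
  shows "conjugation_field R (\<lambda>x. x [^] m) (\<lambda>x. x = \<zero> \<or> x [^] ((m\<^sup>2 - 1) div 2) = \<one>) m"
proof -
  define e where "e = (m\<^sup>2 - 1) div 2"
  obtain a where a: "m = 2 * a + 1" using odd by (rule oddE)
  have "a > 0" using a \<open>m > 1\<close> by simp
  have e: "e = 2 * a * (a + 1)" by (simp add: e_def a power2_eq_square algebra_simps)
  have e2: "m\<^sup>2 - 1 = 2 * e" by (simp add: e a power2_eq_square algebra_simps)
  have unit_pow: "x [^] (2 * e) = \<one>" if "x \<in> carrier R" "x \<noteq> \<zero>" for x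
  proof -
    have "card (Units R) = 2 * e" using fin card e2 by (simp add: field_Units)
    then show ?thesis
      using units_power_order_eq_one[of x] fin that by (simp add: field_Units)
  qed
  have pm1: "x [^] e = \<one> \<or> x [^] e = \<ominus> \<one>" if "x \<in> carrier R" "x \<noteq> \<zero>" for x
    using square_eq_one[of "x [^] e"] unit_pow[OF that] that by (simp add: nat_pow_mult mult_2)
  obtain g where g: "g \<in> carrier R" "g \<noteq> \<zero>" and gen: "carrier R - {\<zero>} = {g [^] i |i::nat. i \<in> UNIV}"
    using finite_field_mult_group_has_gen[OF fin] by auto
  \<comment> \<open>Otherwise the powers of \<open>g\<close> would take at most \<open>e\<close>
    values, fewer than the 2 e nonzero elements.\<close>
  have ge: "g [^] e \<noteq> \<one>"
  proof
    assume g1: "g [^] e = \<one>"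
    have "g [^] i \<in> (\<lambda>j. g [^] j) ` {..<e}" for i :: nat
    proof -
      have "g [^] i = g [^] (e * (i div e) + i mod e)" by simp
      also have "\<dots> = (g [^] e) [^] (i div e) \<otimes> g [^] (i mod e)"
        using g by (simp only: nat_pow_mult[symmetric] nat_pow_pow)
      finally have "g [^] i = g [^] (i mod e)" using g g1 by simp
      then show ?thesis using e \<open>a > 0\<close> by simp
    qed
    then have "carrier R - {\<zero>} \<subseteq> (\<lambda>j. g [^] j) ` {..<e}" unfolding gen by auto
    then have "card (carrier R - {\<zero>}) \<le> card {..<e}"
      by (rule surj_card_le[rotated]) simp
    then show False using fin card e2 e \<open>a > 0\<close> by simp
  qed
  have ge': "g [^] e = \<ominus> \<one>" using pm1[OF g] ge by blast
  have one: "\<ominus> \<one> \<noteq> \<one>" using ge ge' by auto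
  have mm: "\<ominus> \<one> \<otimes> \<ominus> \<one> = \<one>" by (simp add: l_minus)
  define sq where "sq x \<longleftrightarrow> x = \<zero> \<or> x [^] e = \<one>" for x
  have sq_mult: "sq (x \<otimes> y) \<longleftrightarrow> (sq x \<longleftrightarrow> sq y)"
    if "x \<in> carrier R" "y \<in> carrier R" "x \<noteq> \<zero>" "y \<noteq> \<zero>" for x y
    using pm1[OF that(1,3)] pm1[OF that(2,4)] that one mm
    by (auto simp: sq_def integral_iff nat_pow_distrib)
  have pow_pred: "x [^] (2 * a) = c" if "x \<in> carrier R" "c \<in> carrier R" "x \<noteq> \<zero>" "x [^] m = c \<otimes> x" for x c
    using that m_rcancel[of x "x [^] (2 * a)" c] by (simp add: a)
  have "conjugation_field R (\<lambda>x. x [^] m) sq m"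
  proof unfold_locales
    show "finite (carrier R)" "card (carrier R) = m\<^sup>2" by (fact fin card)+
    show "\<one> \<oplus> \<one> \<noteq> \<zero>"
      using one sum_zero_eq_neg[of \<one> \<one>] by auto
    show "x [^] m \<in> carrier R" if "x \<in> carrier R" for x using that by simp
    show "(x \<oplus> y) [^] m = x [^] m \<oplus> y [^] m" if "x \<in> carrier R" "y \<in> carrier R" for x y
      unfolding m by (rule add_pow_prime_power_char[OF p char that])
    show "(x \<otimes> y) [^] m = x [^] m \<otimes> y [^] m" if "x \<in> carrier R" "y \<in> carrier R" for x y
      using that by (rule nat_pow_distrib)
    show "(x [^] m) [^] m = x" if x: "x \<in> carrier R" for x
    proof (cases "x = \<zero>")
      case True
      then show ?thesis using \<open>m > 1\<close> by (simp add: nat_pow_zero)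
    next
      case False
      have "m * m = Suc (2 * e)" by (simp add: e a algebra_simps)
      then show ?thesis using unit_pow[OF x False] x by (simp add: nat_pow_pow)
    qed
    show "\<exists>x\<in>carrier R. x \<noteq> \<zero> \<and> x [^] m = \<ominus> x"
    proof (intro bexI conjI)
      \<comment> \<open>The exponent a + 1 is (m + 1) / 2, chosen so that the (m - 1)-th power of
        \<open>?l\<close> is g^e = -1.\<close>
      let ?l = "g [^] (a + 1)"
      show l: "?l \<in> carrier R" using g by simp
      show "?l \<noteq> \<zero>" using gen by blast
      have "?l [^] (2 * a) = g [^] e" using g by (simp only: nat_pow_pow e mult.commute)
      then show "?l [^] m = \<ominus> ?l" using l ge' unfolding a by (simp add: l_minus del: nat_pow_Suc2)
    qed
    show "sq \<zero>" by (simp add: sq_def)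
    show "sq (x \<otimes> y) = (sq x = sq y)"
      if "x \<in> carrier R" "y \<in> carrier R" "x \<noteq> \<zero>" "y \<noteq> \<zero>" for x y
      by (rule sq_mult[OF that])
    show "sq (x [^] m) = sq x" if x: "x \<in> carrier R" for x
    proof (cases "x = \<zero>")
      case True
      then show ?thesis using \<open>m > 1\<close> by (simp add: nat_pow_zero)
    next
      case False
      have "(\<ominus> \<one>) [^] (2 * a) = \<one>"
        using nat_pow_pow[of "\<ominus> \<one>" 2 a] mm by (simp add: numeral_2_eq_2)
      then have "(\<ominus> \<one>) [^] m = \<ominus> \<one>" by (simp add: a)
      moreover have "(x [^] m) [^] e = (x [^] e) [^] m" using x by (simp add: nat_pow_pow mult.commute)
      moreover have "x [^] m \<noteq> \<zero>"
        using Units_pow_closed[of x m] x False by (simp add: field_Units)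
      ultimately show ?thesis
        using pm1[OF x False] False one by (auto simp: sq_def)
    qed
    show "sq x" if x: "x \<in> carrier R" and "x [^] m = x" for x
    proof (cases "x = \<zero>")
      case False
      have "x [^] (2 * a) = \<one>" using pow_pred[of x \<one>] x that False by simp
      then have "x [^] e = \<one>" using nat_pow_pow[OF x, of "2 * a" "a + 1"] by (simp add: e)
      then show ?thesis by (simp add: sq_def)
    qed (simp add: sq_def)
    show "sq c" if "x \<in> carrier R" "c \<in> carrier R" "x \<noteq> \<zero>" "x [^] m = c \<otimes> x" for x c
    proof -
      have "c [^] e = x [^] (2 * a * e)" using pow_pred[OF that] that(1) by (simp add: nat_pow_pow flip: pow_pred[OF that])
      also have "\<dots> = (x [^] (2 * e)) [^] a" using that(1) by (simp add: nat_pow_pow algebra_simps)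
      finally show ?thesis using unit_pow that by (simp add: sq_def)
    qed
    show "2 * card {x \<in> carrier R. sq x} = m\<^sup>2 + 1"
    proof -
      let ?S = "{x \<in> carrier R. sq x}"
      let ?N = "{x \<in> carrier R. \<not> sq x}"
      have nsg: "\<not> sq g" using ge g by (simp add: sq_def)
      \<comment> \<open>Multiplication by the nonsquare \<open>g\<close> carries nonzero squares to
        nonsquares; zero counts as a square, whence the extra 1 in the total.\<close>
      have "bij_betw (\<lambda>x. g \<otimes> x) (?S - {\<zero>}) ?N"
      proof (rule bij_betw_imageI)
        show "inj_on (\<lambda>x. g \<otimes> x) (?S - {\<zero>})" using g by (auto simp: inj_on_def m_lcancel)
        show "(\<lambda>x. g \<otimes> x) ` (?S - {\<zero>}) = ?N"
        proof (intro equalityI subsetI)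
          fix y assume "y \<in> (\<lambda>x. g \<otimes> x) ` (?S - {\<zero>})"
          then show "y \<in> ?N" using sq_mult g nsg by auto
        next
          fix y assume y: "y \<in> ?N"
          then have y0: "y \<noteq> \<zero>" by (auto simp: sq_def)
          have gu: "g \<in> Units R" using g by (simp add: field_Units)
          define x where "x = inv g \<otimes> y"
          have x: "x \<in> carrier R" "y = g \<otimes> x"
            using gu g y by (simp_all add: x_def flip: m_assoc)
          then have "x \<noteq> \<zero>" using y0 g by auto
          then have "sq x" using sq_mult[of g x] x g y nsg by auto
          then show "y \<in> (\<lambda>x. g \<otimes> x) ` (?S - {\<zero>})" using x \<open>x \<noteq> \<zero>\<close> by blast
        qed
      qed
      then have "card (?S - {\<zero>}) = card ?N" by (rule bij_betw_same_card)
      moreover have "\<zero> \<in> ?S" by (simp add: sq_def)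
      then have "card ?S = Suc (card (?S - {\<zero>}))"
        using fin by (intro card.remove) auto
      moreover have "card ?S + card ?N = card (?S \<union> ?N)"
        using fin by (subst card_Un_disjoint) auto
      moreover have "?S \<union> ?N = carrier R" by auto
      ultimately show ?thesis using card by simp
    qed
  qed
  then show ?thesis unfolding sq_def e_def .
qed

theorem theorem2:
  fixes p n :: nat
  assumes "prime p" and "odd p" and "n \<ge> 1"
  shows "\<exists>(P :: nat set) (L :: nat set) I tpt tln.
           projective_plane_of_order P L I (p ^ (2 * n)) \<and>
           is_polarity P L I tpt tln \<and>
           \<not> orthogonal_polarity P I tpt (p ^ (2 * n)) \<and>
           \<not> unitary_polarity P I tpt (p ^ (2 * n)) \<and>
           real (independence_number P (polarity_adj I tpt))
             \<ge> 1 / 2 * real (p ^ (2 * n)) * (sqrt (real (p ^ (2 * n))) - 1)"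
proof -
  define m where "m = p ^ n"
  have q: "p ^ (2 * n) = m\<^sup>2" by (simp add: m_def power_even_eq)
  have m: "odd m" "m > 1"
    using assms one_less_power[OF prime_gt_1_nat[OF assms(1)], of n] by (simp_all add: m_def)
  obtain K :: "((int list \<times> nat) multiset \<Rightarrow> int) ring" where K: "field K" "finite (carrier K)"
    "card (carrier K) = m\<^sup>2" "[p] \<cdot>\<^bsub>K\<^esub> \<one>\<^bsub>K\<^esub> = \<zero>\<^bsub>K\<^esub>"
    using exists_finite_field[OF assms(1), of "2 * n"] assms(3) q by auto
  interpret conjugation_field K "\<lambda>x. x [^]\<^bsub>K\<^esub> m"
    "\<lambda>x. x = \<zero>\<^bsub>K\<^esub> \<or> x [^]\<^bsub>K\<^esub> ((m\<^sup>2 - 1) div 2) = \<one>\<^bsub>K\<^esub>" m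
    by (rule field.finite_field_conjugation[OF K(1-3) assms(1) K(4) m_def m])
  define s where "s = card {x \<in> carrier K. x = \<zero>\<^bsub>K\<^esub> \<or> x [^]\<^bsub>K\<^esub> ((m\<^sup>2 - 1) div 2) = \<one>\<^bsub>K\<^esub>}"
  have s: "2 * s = m\<^sup>2 + 1" unfolding s_def by (rule card_sq)
  obtain P :: "nat set" and I where P: "projective_plane_of_order P P I (m\<^sup>2)"
    "is_polarity P P I (\<lambda>x. x) (\<lambda>x. x)"
    "card (absolute_points P I (\<lambda>x. x)) = 1 + m * s"
    "1 + m * s \<le> independence_number P (polarity_adj I (\<lambda>x. x))"
    using hughes_plane_polarity unfolding s_def by blast
  \<comment> \<open>Equality would give s = m, and then 2 s = m^2 + 1 reads (m - 1)^2 = 0.\<close>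
  have "m * s \<noteq> m\<^sup>2"
  proof
    assume "m * s = m\<^sup>2"
    then have "s = m" using m by (simp add: power2_eq_square)
    then have "(int m - 1)\<^sup>2 = 0" using arg_cong[OF s, of int] by (simp add: power2_eq_square algebra_simps)
    then show False using m by simp
  qed
  then have "\<not> orthogonal_polarity P I (\<lambda>x. x) (m\<^sup>2)"
    by (simp add: orthogonal_polarity_def P(3))
  \<comment> \<open>A unitary polarity would have m^3 + 1 absolute points, forcing s = m^2 and hence
    m = 1.\<close>
  moreover have "\<not> unitary_polarity P I (\<lambda>x. x) (m\<^sup>2)"
  proof
    assume "unitary_polarity P I (\<lambda>x. x) (m\<^sup>2)"
    then have "real (m * s) = real (m\<^sup>2) powr (3 / 2)"
      by (simp add: unitary_polarity_def P(3))
    also have "real (m\<^sup>2) = real m powr 2" using m by (simp add: powr_numeral)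
    also have "(real m powr 2) powr (3 / 2) = real m powr 3" by (simp only: powr_powr) simp
    also have "\<dots> = real (m ^ 3)" using m by (simp add: powr_numeral)
    finally have "m * s = m * m\<^sup>2" by (simp only: of_nat_eq_iff) (simp add: power2_eq_square power3_eq_cube)
    then have "s = m\<^sup>2" using m by simp
    then have "m\<^sup>2 = 1" using s by simp
    then show False using m by simp
  qed
  \<comment> \<open>The number of absolute points exceeds the bound m^2 (m - 1) / 2 by 1 + (m^2 + m)
    / 2.\<close>
  moreover have "1 / 2 * real (m\<^sup>2) * (sqrt (real (m\<^sup>2)) - 1) \<le> real (independence_number P (polarity_adj I (\<lambda>x. x)))"
  proof -
    have "2 * real s = (real m)\<^sup>2 + 1" using arg_cong[OF s, of real] by simp
    then have "1 + real m * real s = 1 + real m * ((real m)\<^sup>2 + 1) / 2" by (simp add: field_simps)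
    moreover have "1 / 2 * real (m\<^sup>2) * (sqrt (real (m\<^sup>2)) - 1) \<le> 1 + real m * ((real m)\<^sup>2 + 1) / 2"
      by (simp add: power2_eq_square field_simps)
    moreover have "1 + real m * real s = real (1 + m * s)" by simp
    moreover have "real (1 + m * s) \<le> real (independence_number P (polarity_adj I (\<lambda>x. x)))"
      using P(4) by (simp only: of_nat_le_iff)
    ultimately show ?thesis by linarith
  qed
  ultimately show ?thesis
    unfolding q using P(1,2) by blast
qed

end
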